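(* Let $\mathscr{V}$ be a topological category over $\mathsf{Set}$, with topological functor $|-| : \mathscr{V} \to \mathsf{Set}$, equipped with the cartesian symmetric monoidal structure $(\otimes, I) = (\times, 1)$, and suppose that $\mathscr{V}$ is cartesian closed. Let $\mathcal{S}$ be a set, let $\Sigma$ be a $\mathscr{V}$-enriched $\mathcal{S}$-sorted signature with underlying classical $\mathcal{S}$-sorted signature $|\Sigma|$, and let $X$ be an object of $\mathscr{V}^{\mathcal{S}}$. Then the carrier object $U^\Sigma F^\Sigma X \in \mathrm{ob}\,\mathscr{V}^{\mathcal{S}}$ of the free $\Sigma$-algebra $F^\Sigma X$ on $X$ is the supremum $$U^\Sigma F^\Sigma X = \bigvee_{n \geq 0} \Omega^n(X)$$ in the fibre of $\mathscr{V}^{\mathcal{S}}$ over the $\mathcal{S}$-sorted set $\mathsf{Term}_{|\Sigma|}(|X|)$ of the following objects $\Omega^n(X)$ of $\mathscr{V}^{\mathcal{S}}$ ($n \geq 0$): 1. $\Omega^0(X)$ is the final $\mathscr{V}^{\mathcal{S}}$-structure on $\mathsf{Term}_{|\Sigma|}(|X|)$ induced by the $\mathcal{S}$-sorted inclusion function $\eta : |X| \to \mathsf{Term}_{|\Sigma|}(|X|)$. 2. Given $\Omega^n(X) \in \mathsf{Fib}(\mathsf{Term}_{|\Sigma|}(|X|))$, for each sort $S \in \mathcal{S}$ let $\Omega^n(X, S) \in \mathsf{Fib}(\mathsf{Term}_{|\Sigma|}(|X|)_S)$ be the final $\mathscr{V}$-structure on the set $\mathsf{Term}_{|\Sigma|}(|X|)_S$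 induced by the functions $$\widehat{\sigma} : \left|P \times \Omega^n(X)_{S_1} \times \cdots \times \Omega^n(X)_{S_m}\right| \to \mathsf{Term}_{|\Sigma|}(|X|)_S, \qquad (p, t_1, \ldots, t_m) \mapsto \sigma_p(t_1, \ldots, t_m),$$ for all $\sigma \in \Sigma$ of type $((S_1, \ldots, S_m), S, P)$ (with output sort $S$). Then $$\Omega^{n+1}(X) := \Omega^n(X) \vee \left(\Omega^n(X, S)\right)_{S \in \mathcal{S}}$$ in the fibre over $\mathsf{Term}_{|\Sigma|}(|X|)$.
   Context: Topological categories. A concrete category over a category $\mathscr{X}$ is a category $\mathscr{V}$ with a faithful functor $|-| : \mathscr{V} \to \mathscr{X}$; an $\mathscr{X}$-morphism $f : |V| \to |W|$ is $\mathscr{V}$-admissible if it lifts (uniquely) to a morphism $V \to W$. The fibre $\mathsf{Fib}(X)$ is the preordered class of objects $V$ with $|V| = X$, where $V \leq V'$ iff $1_X$ is an admissible morphism $V \to V'$; $\mathscr{V}$ is amnestic if all fibres are partially ordered. A (possibly large) source $(f_i : V \to V_i)_{i}$ is initial if for all $W$ and $f : |W| \to |V|$, $f$ is admissible iff all $f_i \circ f$ are; dually, a sink $(g_i : V_i \to V)_i$ is final if for all $W$ and $g : |V| \to |W|$, $g$ is admissible iff all $g \circ g_i$ are. $\mathscr{V}$ is topological over $\mathscr{X}$ if it is amnestic and every (possibly large) structured source $(f_i : X \to |V_i|)_i$ has an initial lift: an object $V$ with $|V| = X$, each $f_i$ admissible, and $(f_i : V \to V_i)_i$ initial. Then dually every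 structured sink $(g_i : |V_i| \to X)_i$ has a final lift $(g_i : V_i \to V)_i$, and $V$ is called the final structure on $X$ induced by the $g_i$; moreover every fibre is a (possibly large) complete lattice. $|-|$ strictly preserves limits and colimits, e.g. $|X \times Y| = |X| \times |Y|$. The category $\mathscr{V}^{\mathcal{S}}$ is topological over $\mathsf{Set}^{\mathcal{S}}$ via $|(V_S)_{S}| = (|V_S|)_{S}$; initial and final structures and fibres are computed componentwise. $\mathcal{S}^*$ is the set of finite sequences of elements of $\mathcal{S}$. Signatures (with $\otimes = \times$). A $\mathscr{V}$-enriched $\mathcal{S}$-sorted signature is a set $\Sigma$ of operation symbols, each equipped with a type $((S_1, \ldots, S_n), S, P)$: input sorts $(S_1,\ldots,S_n) \in \mathcal{S}^*$, output sort $S \in \mathcal{S}$, parameter object $P \in \mathrm{ob}\,\mathscr{V}$. A $\Sigma$-algebra is an object $A = (A_S)_{S}$ of $\mathscr{V}^{\mathcal{S}}$ with, for each $\sigma \in \Sigma$ of type $((S_1, \ldots, S_n), S, P)$, a $\mathscr{V}$-morphism $\sigma^A : P \times (A_{S_1} \times \cdots \times A_{S_n}) \to A_S$. A morphism $f : A \to B$ of $\Sigma$-algebras is a morphism of $\mathscr{V}^{\mathcal{S}}$ with $f_S \circ \sigma^A = \sigma^B \circ (1_P \times (f_{S_1} \times \cdots \times f_{S_n}))$ for all $\sigma$. $U^\Sigma : \Sigma\text{-}\mathsf{Alg} \to \mathscr{V}^{\mathcal{S}}$ is the forgetful functor. A classical $\mathcal{S}$-sorted signature is the case $\mathscr{V}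 = \mathsf{Set}$ with all parameters equal to the one-point set. Underlying classical signature. $|\Sigma|$ has an operation symbol $\sigma_p$ with input sorts $(S_1,\ldots,S_n)$ and output sort $S$ for each $\sigma \in \Sigma$ of type $((S_1,\ldots,S_n),S,P)$ and each $p \in |P|$. Each $\Sigma$-algebra $A$ has an underlying $|\Sigma|$-algebra $|A|$ with carrier $(|A_S|)_S$ and $\sigma_p^{|A|} = \sigma^A(p, -)$. Classical free algebras. For an $\mathcal{S}$-sorted set $Y$, $\mathsf{Term}_{|\Sigma|}(Y)$ is the $\mathcal{S}$-sorted set of ground terms with constants from $Y$: $Y_S \subseteq \mathsf{Term}_{|\Sigma|}(Y)_S$, and for each $\tau \in |\Sigma|$ with input sorts $(S_1, \ldots, S_n)$, output sort $S$, and $t_i \in \mathsf{Term}_{|\Sigma|}(Y)_{S_i}$, one has $\tau(t_1, \ldots, t_n) \in \mathsf{Term}_{|\Sigma|}(Y)_S$. With the evident operations it is the free $|\Sigma|$-algebra $F^{|\Sigma|} Y$. $F^\Sigma$ denotes the left adjoint of $U^\Sigma$ (which exists), chosen so that $F^\Sigma \dashv U^\Sigma$ strictly lifts $F^{|\Sigma|} \dashv U^{|\Sigma|}$; in particular the underlying $|\Sigma|$-algebra of $F^\Sigma X$ is $F^{|\Sigma|}|X|$ and the unit has as underlying function the inclusion $|X| \hookrightarrow \mathsf{Term}_{|\Sigma|}(|X|)$. *)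

theory Defs
  imports "HOL-Library.FuncSet"
begin

text \<open>The base category of all sets has to live inside one HOL type. A type of class zfc is a
  (second-order) model of ZFC: elts maps every set to the HOL set of its elements, and the choice
  axiom is the one of HOL. Small HOL sets over such a type are those that correspond to an element
  of the universe; arbitrary HOL sets over it play the role of classes.\<close>

class zfc =
  fixes elts :: "'a \<Rightarrow> 'a set"
  assumes elts_extensional: "elts x = elts y \<Longrightarrow> x = y"
    and elts_foundation: "wf {(x, y). x \<in> elts y}"
    and elts_subset: "B \<subseteq> elts x \<Longrightarrow> B \<in> range elts"
    and elts_Union: "(\<Union>y\<in>elts x. elts y) \<in> range elts"
    and elts_Pow: "{y. elts y \<subseteq> elts x} \<in> range elts"
    and elts_replacement: "f ` elts x \<in> range elts"
    and elts_infinity: "range (g :: nat \<Rightarrow> 'a) \<in> range elts"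

definition small :: "'u::zfc set \<Rightarrow> bool"
  where "small A \<longleftrightarrow> A \<in> range elts"

definition mkset :: "'u::zfc set \<Rightarrow> 'u"
  where "mkset A = inv elts A"

definition kpair :: "'u::zfc \<Rightarrow> 'u \<Rightarrow> 'u"
  where "kpair x y = mkset {mkset {x}, mkset {x, y}}"

text \<open>Finite tuples, coded by iterated Kuratowski pairs ending in the empty set; the coding is
  injective on lists.\<close>

primrec tuple :: "'u::zfc list \<Rightarrow> 'u" where
  "tuple [] = mkset {}"
| "tuple (x # xs) = kpair x (tuple xs)"

definition coord :: "nat \<Rightarrow> 'u::zfc \<Rightarrow> 'u"
  where "coord i z = inv tuple z ! i"

definition tuples :: "'u::zfc set list \<Rightarrow> 'u set"
  where "tuples As = {tuple xs |xs. list_all2 (\<in>) xs As}"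

text \<open>Hom-sets need not be disjoint, so composition also takes the three objects involved:
  Cmp C X Y Z g f is the composite of f from X to Y and g from Y to Z.\<close>

record ('o, 'm) cat =
  Obj :: "'o set"
  Hom :: "'o \<Rightarrow> 'o \<Rightarrow> 'm set"
  Idt :: "'o \<Rightarrow> 'm"
  Cmp :: "'o \<Rightarrow> 'o \<Rightarrow> 'o \<Rightarrow> 'm \<Rightarrow> 'm \<Rightarrow> 'm"

locale category =
  fixes C :: "('o, 'm) cat"
  assumes Idt_Hom: "X \<in> Obj C \<Longrightarrow> Idt C X \<in> Hom C X X"
    and Cmp_Hom: "\<lbrakk>X \<in> Obj C; Y \<in> Obj C; Z \<in> Obj C; f \<in> Hom C X Y; g \<in> Hom C Y Z\<rbrakk>
      \<Longrightarrow> Cmp C X Y Z g f \<in> Hom C X Z"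
    and Cmp_Idt_right: "\<lbrakk>X \<in> Obj C; Y \<in> Obj C; f \<in> Hom C X Y\<rbrakk>
      \<Longrightarrow> Cmp C X X Y f (Idt C X) = f"
    and Cmp_Idt_left: "\<lbrakk>X \<in> Obj C; Y \<in> Obj C; f \<in> Hom C X Y\<rbrakk>
      \<Longrightarrow> Cmp C X Y Y (Idt C Y) f = f"
    and Cmp_assoc: "\<lbrakk>W \<in> Obj C; X \<in> Obj C; Y \<in> Obj C; Z \<in> Obj C;
        f \<in> Hom C W X; g \<in> Hom C X Y; h \<in> Hom C Y Z\<rbrakk>
      \<Longrightarrow> Cmp C W Y Z h (Cmp C W X Y g f) = Cmp C W X Z (Cmp C X Y Z h g) f"

record ('o, 'm, 'p, 'n) func =
  Ob :: "'o \<Rightarrow> 'p"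
  Ar :: "'o \<Rightarrow> 'o \<Rightarrow> 'm \<Rightarrow> 'n"

locale cat_functor = dom: category C + cod: category D
  for C :: "('o, 'm) cat" and D :: "('p, 'n) cat" +
  fixes F :: "('o, 'm, 'p, 'n) func"
  assumes Ob_Obj: "X \<in> Obj C \<Longrightarrow> Ob F X \<in> Obj D"
    and Ar_Hom: "\<lbrakk>X \<in> Obj C; Y \<in> Obj C; f \<in> Hom C X Y\<rbrakk>
      \<Longrightarrow> Ar F X Y f \<in> Hom D (Ob F X) (Ob F Y)"
    and Ar_Idt: "X \<in> Obj C \<Longrightarrow> Ar F X X (Idt C X) = Idt D (Ob F X)"
    and Ar_Cmp: "\<lbrakk>X \<in> Obj C; Y \<in> Obj C; Z \<in> Obj C; f \<in> Hom C X Y; g \<in> Hom C Y Z\<rbrakk>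
      \<Longrightarrow> Ar F X Z (Cmp C X Y Z g f)
        = Cmp D (Ob F X) (Ob F Y) (Ob F Z) (Ar F Y Z g) (Ar F X Y f)"

locale left_adjoint = left: cat_functor C D F + right: cat_functor D C G
  for C :: "('o, 'm) cat" and D :: "('p, 'n) cat"
    and F :: "('o, 'm, 'p, 'n) func" and G :: "('p, 'n, 'o, 'm) func" +
  fixes \<eta> :: "'o \<Rightarrow> 'm"
  assumes unit_Hom: "X \<in> Obj C \<Longrightarrow> \<eta> X \<in> Hom C X (Ob G (Ob F X))"
    and unit_natural: "\<lbrakk>X \<in> Obj C; Y \<in> Obj C; f \<in> Hom C X Y\<rbrakk>
      \<Longrightarrow> Cmp C X (Ob G (Ob F X)) (Ob G (Ob F Y)) (Ar G (Ob F X) (Ob F Y) (Ar F X Y f)) (\<eta> X)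
        = Cmp C X Y (Ob G (Ob F Y)) (\<eta> Y) f"
    and unit_universal: "\<lbrakk>X \<in> Obj C; A \<in> Obj D; g \<in> Hom C X (Ob G A)\<rbrakk>
      \<Longrightarrow> \<exists>!h. h \<in> Hom D (Ob F X) A
        \<and> Cmp C X (Ob G (Ob F X)) (Ob G A) (Ar G (Ob F X) A h) (\<eta> X) = g"

definition set_cat :: "('u::zfc set, 'u \<Rightarrow> 'u) cat"
  where "set_cat = \<lparr>Obj = {A. small A}, Hom = (\<lambda>A B. A \<rightarrow>\<^sub>E B),
    Idt = (\<lambda>A. \<lambda>x\<in>A. x), Cmp = (\<lambda>A B C g f. compose A g f)\<rparr>"

definition pow_cat :: "('o, 'm) cat \<Rightarrow> 's set \<Rightarrow> ('s \<Rightarrow> 'o, 's \<Rightarrow> 'm) cat"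
  where "pow_cat C S = \<lparr>Obj = (S \<rightarrow>\<^sub>E Obj C), Hom = (\<lambda>X Y. \<Pi>\<^sub>E s\<in>S. Hom C (X s) (Y s)),
    Idt = (\<lambda>X. \<lambda>s\<in>S. Idt C (X s)),
    Cmp = (\<lambda>X Y Z g f. \<lambda>s\<in>S. Cmp C (X s) (Y s) (Z s) (g s) (f s))\<rparr>"

definition pow_func ::
    "('o, 'm, 'p, 'n) func \<Rightarrow> 's set \<Rightarrow> ('s \<Rightarrow> 'o, 's \<Rightarrow> 'm, 's \<Rightarrow> 'p, 's \<Rightarrow> 'n) func"
  where "pow_func F S = \<lparr>Ob = (\<lambda>X. \<lambda>s\<in>S. Ob F (X s)),
    Ar = (\<lambda>X Y f. \<lambda>s\<in>S. Ar F (X s) (Y s) (f s))\<rparr>"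

text \<open>Throughout, B is the base category and U is the functor from V to B.\<close>

locale concrete_category = cat_functor V B U
  for V :: "('v, 'm) cat" and B :: "('b, 'f) cat" and U :: "('v, 'm, 'b, 'f) func" +
  assumes faithful: "\<lbrakk>v \<in> Obj V; w \<in> Obj V\<rbrakk> \<Longrightarrow> inj_on (Ar U v w) (Hom V v w)"

definition admissible ::
    "('v, 'm) cat \<Rightarrow> ('v, 'm, 'b, 'f) func \<Rightarrow> 'v \<Rightarrow> 'v \<Rightarrow> 'f \<Rightarrow> bool"
  where "admissible V U v w f \<longleftrightarrow> f \<in> Ar U v w ` Hom V v w"

definition fibre :: "('v, 'm) cat \<Rightarrow> ('v, 'm, 'b, 'f) func \<Rightarrow> 'b \<Rightarrow> 'v set"
  where "fibre V U b = {v \<in> Obj V. Ob U v = b}"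

definition fib_le ::
    "('b, 'f) cat \<Rightarrow> ('v, 'm) cat \<Rightarrow> ('v, 'm, 'b, 'f) func \<Rightarrow> 'b \<Rightarrow> 'v \<Rightarrow> 'v \<Rightarrow> bool"
  where "fib_le B V U b v w
    \<longleftrightarrow> v \<in> fibre V U b \<and> w \<in> fibre V U b \<and> admissible V U v w (Idt B b)"

definition is_fib_sup ::
    "('b, 'f) cat \<Rightarrow> ('v, 'm) cat \<Rightarrow> ('v, 'm, 'b, 'f) func \<Rightarrow> 'b \<Rightarrow> 'v set \<Rightarrow> 'v \<Rightarrow> bool"
  where "is_fib_sup B V U b A v \<longleftrightarrow> A \<subseteq> fibre V U b \<and> v \<in> fibre V U b
    \<and> (\<forall>a\<in>A. fib_le B V U b a v)
    \<and> (\<forall>w\<in>fibre V U b. (\<forall>a\<in>A. fib_le B V U b a w) \<longrightarrow> fib_le B V U b v w)"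

definition fib_sup ::
    "('b, 'f) cat \<Rightarrow> ('v, 'm) cat \<Rightarrow> ('v, 'm, 'b, 'f) func \<Rightarrow> 'b \<Rightarrow> 'v set \<Rightarrow> 'v"
  where "fib_sup B V U b A = (THE v. is_fib_sup B V U b A v)"

text \<open>A (possibly large) structured source or sink is given by the set of pairs of its objects and
  morphisms; initiality and finality do not depend on how the family is indexed.\<close>

definition structured_source ::
    "('b, 'f) cat \<Rightarrow> ('v, 'm) cat \<Rightarrow> ('v, 'm, 'b, 'f) func \<Rightarrow> 'b \<Rightarrow> ('v \<times> 'f) set \<Rightarrow> bool"
  where "structured_source B V U b Src
    \<longleftrightarrow> (\<forall>(v, f)\<in>Src. v \<in> Obj V \<and> f \<in> Hom B b (Ob U v))"

definition is_initial_lift ::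
    "('b, 'f) cat \<Rightarrow> ('v, 'm) cat \<Rightarrow> ('v, 'm, 'b, 'f) func \<Rightarrow> 'b \<Rightarrow> ('v \<times> 'f) set \<Rightarrow> 'v \<Rightarrow> bool"
  where "is_initial_lift B V U b Src v \<longleftrightarrow> v \<in> fibre V U b
    \<and> (\<forall>(w, f)\<in>Src. admissible V U v w f)
    \<and> (\<forall>z\<in>Obj V. \<forall>g\<in>Hom B (Ob U z) b. admissible V U z v g
        \<longleftrightarrow> (\<forall>(w, f)\<in>Src. admissible V U z w (Cmp B (Ob U z) b (Ob U w) f g)))"

definition is_final_lift ::
    "('b, 'f) cat \<Rightarrow> ('v, 'm) cat \<Rightarrow> ('v, 'm, 'b, 'f) func \<Rightarrow> 'b \<Rightarrow> ('v \<times> 'f) set \<Rightarrow> 'v \<Rightarrow> bool"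
  where "is_final_lift B V U b Snk v \<longleftrightarrow> v \<in> fibre V U b
    \<and> (\<forall>(w, f)\<in>Snk. admissible V U w v f)
    \<and> (\<forall>z\<in>Obj V. \<forall>g\<in>Hom B b (Ob U z). admissible V U v z g
        \<longleftrightarrow> (\<forall>(w, f)\<in>Snk. admissible V U w z (Cmp B (Ob U w) b (Ob U z) g f)))"

definition final_structure ::
    "('b, 'f) cat \<Rightarrow> ('v, 'm) cat \<Rightarrow> ('v, 'm, 'b, 'f) func \<Rightarrow> 'b \<Rightarrow> ('v \<times> 'f) set \<Rightarrow> 'v"
  where "final_structure B V U b Snk = (THE v. is_final_lift B V U b Snk v)"

locale topological_category = concrete_category V B U
  for V :: "('v, 'm) cat" and B :: "('b, 'f) cat" and U :: "('v, 'm, 'b, 'f) func" +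
  assumes amnestic: "\<lbrakk>fib_le B V U b v w; fib_le B V U b w v\<rbrakk> \<Longrightarrow> v = w"
    and initial_lift: "\<lbrakk>b \<in> Obj B; structured_source B V U b Src\<rbrakk>
      \<Longrightarrow> \<exists>v. is_initial_lift B V U b Src v"

definition is_product :: "('o, 'm) cat \<Rightarrow> 'o list \<Rightarrow> 'o \<Rightarrow> (nat \<Rightarrow> 'm) \<Rightarrow> bool"
  where "is_product C Xs Q \<pi> \<longleftrightarrow> Q \<in> Obj C \<and> (\<forall>i<length Xs. \<pi> i \<in> Hom C Q (Xs ! i))
    \<and> (\<forall>Z\<in>Obj C. \<forall>f. (\<forall>i<length Xs. f i \<in> Hom C Z (Xs ! i))
        \<longrightarrow> (\<exists>!h. h \<in> Hom C Z Q \<and> (\<forall>i<length Xs. Cmp C Z Q (Xs ! i) (\<pi> i) h = f i)))"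

text \<open>The functor to sets preserves products strictly, so among the products of a list of objects
  of a topological category there is exactly one whose underlying set is the set of tuples and whose
  projections are the coordinate functions. The list of length zero gives the terminal object.\<close>

definition is_strict_product ::
    "('v, 'm) cat \<Rightarrow> ('v, 'm, 'u::zfc set, 'u \<Rightarrow> 'u) func \<Rightarrow> 'v list \<Rightarrow> 'v \<Rightarrow> (nat \<Rightarrow> 'm) \<Rightarrow> bool"
  where "is_strict_product V U Vs Q \<pi> \<longleftrightarrow> is_product V Vs Q \<pi>
    \<and> Ob U Q = tuples (map (Ob U) Vs)
    \<and> (\<forall>i<length Vs. Ar U Q (Vs ! i) (\<pi> i) = (\<lambda>z\<in>Ob U Q. coord i z))"

definition prod_obj ::
    "('v, 'm) cat \<Rightarrow> ('v, 'm, 'u::zfc set, 'u \<Rightarrow> 'u) func \<Rightarrow> 'v list \<Rightarrow> 'v"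
  where "prod_obj V U Vs = (THE Q. \<exists>\<pi>. is_strict_product V U Vs Q \<pi>)"

definition proj ::
    "('v, 'm) cat \<Rightarrow> ('v, 'm, 'u::zfc set, 'u \<Rightarrow> 'u) func \<Rightarrow> 'v list \<Rightarrow> nat \<Rightarrow> 'm"
  where "proj V U Vs i = (THE p. p \<in> Hom V (prod_obj V U Vs) (Vs ! i)
    \<and> Ar U (prod_obj V U Vs) (Vs ! i) p = (\<lambda>z\<in>Ob U (prod_obj V U Vs). coord i z))"

definition prod_map ::
    "('v, 'm) cat \<Rightarrow> ('v, 'm, 'u::zfc set, 'u \<Rightarrow> 'u) func \<Rightarrow> 'v list \<Rightarrow> 'v list \<Rightarrow> 'm list \<Rightarrow> 'm"
  where "prod_map V U Vs Ws fs = (THE h. h \<in> Hom V (prod_obj V U Vs) (prod_obj V U Ws)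
    \<and> (\<forall>i<length Vs. Cmp V (prod_obj V U Vs) (prod_obj V U Ws) (Ws ! i) (proj V U Ws i) h
        = Cmp V (prod_obj V U Vs) (Vs ! i) (Ws ! i) (fs ! i) (proj V U Vs i)))"

definition cartesian_closed ::
    "('v, 'm) cat \<Rightarrow> ('v, 'm, 'u::zfc set, 'u \<Rightarrow> 'u) func \<Rightarrow> bool"
  where "cartesian_closed V U \<longleftrightarrow> (\<forall>X\<in>Obj V. \<forall>Y\<in>Obj V.
    \<exists>E\<in>Obj V. \<exists>ev\<in>Hom V (prod_obj V U [E, X]) Y.
      \<forall>Z\<in>Obj V. \<forall>f\<in>Hom V (prod_obj V U [Z, X]) Y. \<exists>!g. g \<in> Hom V Z E
        \<and> Cmp V (prod_obj V U [Z, X]) (prod_obj V U [E, X]) Y ev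
            (prod_map V U [Z, X] [E, X] [g, Idt V X]) = f)"

text \<open>A classical signature has no parameters; an enriched one adds a parameter object for every
  operation symbol. Sorts and operation symbols are elements of the universe.\<close>

record 'u signature =
  Ops :: "'u set"
  ins :: "'u \<Rightarrow> 'u list"
  out :: "'u \<Rightarrow> 'u"

record ('u, 'v) enriched_signature = "'u signature" +
  par :: "'u \<Rightarrow> 'v"

definition is_enriched_signature ::
    "('v, 'm) cat \<Rightarrow> 'u::zfc set \<Rightarrow> ('u, 'v) enriched_signature \<Rightarrow> bool"
  where "is_enriched_signature V S \<Sigma> \<longleftrightarrow> small (Ops \<Sigma>)
    \<and> (\<forall>\<sigma>\<in>Ops \<Sigma>. set (ins \<Sigma> \<sigma>) \<subseteq> S \<and> out \<Sigma> \<sigma> \<in> S \<and> par \<Sigma> \<sigma> \<in> Obj V)"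

definition arity_obj ::
    "('v, 'm) cat \<Rightarrow> ('v, 'm, 'u::zfc set, 'u \<Rightarrow> 'u) func \<Rightarrow> ('u, 'v) enriched_signature
      \<Rightarrow> ('u \<Rightarrow> 'v) \<Rightarrow> 'u \<Rightarrow> 'v"
  where "arity_obj V U \<Sigma> A \<sigma> = prod_obj V U [par \<Sigma> \<sigma>, prod_obj V U (map A (ins \<Sigma> \<sigma>))]"

definition arity_map ::
    "('v, 'm) cat \<Rightarrow> ('v, 'm, 'u::zfc set, 'u \<Rightarrow> 'u) func \<Rightarrow> ('u, 'v) enriched_signature
      \<Rightarrow> ('u \<Rightarrow> 'v) \<Rightarrow> ('u \<Rightarrow> 'v) \<Rightarrow> ('u \<Rightarrow> 'm) \<Rightarrow> 'u \<Rightarrow> 'm"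
  where "arity_map V U \<Sigma> A B f \<sigma> =
    prod_map V U [par \<Sigma> \<sigma>, prod_obj V U (map A (ins \<Sigma> \<sigma>))] [par \<Sigma> \<sigma>, prod_obj V U (map B (ins \<Sigma> \<sigma>))]
      [Idt V (par \<Sigma> \<sigma>), prod_map V U (map A (ins \<Sigma> \<sigma>)) (map B (ins \<Sigma> \<sigma>)) (map f (ins \<Sigma> \<sigma>))]"

text \<open>An algebra is a pair of its carrier and its family of operations.\<close>

definition alg_cat ::
    "('v, 'm) cat \<Rightarrow> ('v, 'm, 'u::zfc set, 'u \<Rightarrow> 'u) func \<Rightarrow> 'u set \<Rightarrow> ('u, 'v) enriched_signature
      \<Rightarrow> (('u \<Rightarrow> 'v) \<times> ('u \<Rightarrow> 'm), 'u \<Rightarrow> 'm) cat"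
  where "alg_cat V U S \<Sigma> =
    \<lparr>Obj = {(A, a). A \<in> Obj (pow_cat V S)
        \<and> a \<in> (\<Pi>\<^sub>E \<sigma>\<in>Ops \<Sigma>. Hom V (arity_obj V U \<Sigma> A \<sigma>) (A (out \<Sigma> \<sigma>)))},
      Hom = (\<lambda>(A, a) (B, b). {f \<in> Hom (pow_cat V S) A B. \<forall>\<sigma>\<in>Ops \<Sigma>.
        Cmp V (arity_obj V U \<Sigma> A \<sigma>) (A (out \<Sigma> \<sigma>)) (B (out \<Sigma> \<sigma>)) (f (out \<Sigma> \<sigma>)) (a \<sigma>)
        = Cmp V (arity_obj V U \<Sigma> A \<sigma>) (arity_obj V U \<Sigma> B \<sigma>) (B (out \<Sigma> \<sigma>)) (b \<sigma>)
            (arity_map V U \<Sigma> A B f \<sigma>)}),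
      Idt = (\<lambda>(A, a). Idt (pow_cat V S) A),
      Cmp = (\<lambda>(A, a) (B, b) (C, c). Cmp (pow_cat V S) A B C)\<rparr>"

definition alg_forget :: "(('u \<Rightarrow> 'v) \<times> ('u \<Rightarrow> 'm), 'u \<Rightarrow> 'm, 'u \<Rightarrow> 'v, 'u \<Rightarrow> 'm) func"
  where "alg_forget = \<lparr>Ob = fst, Ar = (\<lambda>_ _ f. f)\<rparr>"

text \<open>The symbol written as sigma with subscript p is the pair of sigma and p.\<close>

definition underlying_signature ::
    "('v, 'm, 'u::zfc set, 'u \<Rightarrow> 'u) func \<Rightarrow> ('u, 'v) enriched_signature \<Rightarrow> 'u signature"
  where "underlying_signature U \<Sigma> =
    \<lparr>Ops = {tuple [\<sigma>, p] |\<sigma> p. \<sigma> \<in> Ops \<Sigma> \<and> p \<in> Ob U (par \<Sigma> \<sigma>)},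
      ins = (\<lambda>\<tau>. ins \<Sigma> (coord 0 \<tau>)), out = (\<lambda>\<tau>. out \<Sigma> (coord 0 \<tau>))\<rparr>"

text \<open>Algebras of a classical signature are pairs of an indexed family of sets and a family of
  functions on sets of tuples.\<close>

definition underlying_algebra ::
    "('v, 'm) cat \<Rightarrow> ('v, 'm, 'u::zfc set, 'u \<Rightarrow> 'u) func \<Rightarrow> 'u set \<Rightarrow> ('u, 'v) enriched_signature
      \<Rightarrow> ('u \<Rightarrow> 'v) \<times> ('u \<Rightarrow> 'm) \<Rightarrow> ('u \<Rightarrow> 'u set) \<times> ('u \<Rightarrow> 'u \<Rightarrow> 'u)"
  where "underlying_algebra V U S \<Sigma> = (\<lambda>(A, a).
    (Ob (pow_func U S) A,
     \<lambda>\<tau>\<in>Ops (underlying_signature U \<Sigma>).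
       \<lambda>t\<in>tuples (map (Ob (pow_func U S) A) (ins (underlying_signature U \<Sigma>) \<tau>)).
         let \<sigma> = coord 0 \<tau>; p = coord 1 \<tau>
         in Ar U (arity_obj V U \<Sigma> A \<sigma>) (A (out \<Sigma> \<sigma>)) (a \<sigma>) (tuple [p, t])))"

text \<open>The constant belonging to a generator y is the 1-tuple of y, a compound term is the pair of
  an operation symbol and the tuple of its arguments. This keeps generators and compound terms
  apart, whatever the generators are.\<close>

inductive is_term :: "'u::zfc signature \<Rightarrow> 'u set \<Rightarrow> ('u \<Rightarrow> 'u set) \<Rightarrow> 'u \<Rightarrow> 'u \<Rightarrow> bool"
  for \<Sigma> :: "'u signature" and S :: "'u set" and Y :: "'u \<Rightarrow> 'u set" where
  const: "\<lbrakk>s \<in> S; y \<in> Y s\<rbrakk> \<Longrightarrow> is_term \<Sigma> S Y s (tuple [y])"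
| app: "\<lbrakk>\<tau> \<in> Ops \<Sigma>; list_all2 (is_term \<Sigma> S Y) (ins \<Sigma> \<tau>) ts\<rbrakk>
    \<Longrightarrow> is_term \<Sigma> S Y (out \<Sigma> \<tau>) (tuple [\<tau>, tuple ts])"

definition Term :: "'u::zfc signature \<Rightarrow> 'u set \<Rightarrow> ('u \<Rightarrow> 'u set) \<Rightarrow> 'u \<Rightarrow> 'u set"
  where "Term \<Sigma> S Y = (\<lambda>s\<in>S. {t. is_term \<Sigma> S Y s t})"

definition term_incl :: "'u::zfc set \<Rightarrow> ('u \<Rightarrow> 'u set) \<Rightarrow> 'u \<Rightarrow> 'u \<Rightarrow> 'u"
  where "term_incl S Y = (\<lambda>s\<in>S. \<lambda>y\<in>Y s. tuple [y])"

definition term_algebra ::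
    "'u::zfc signature \<Rightarrow> 'u set \<Rightarrow> ('u \<Rightarrow> 'u set) \<Rightarrow> ('u \<Rightarrow> 'u set) \<times> ('u \<Rightarrow> 'u \<Rightarrow> 'u)"
  where "term_algebra \<Sigma> S Y = (Term \<Sigma> S Y,
    \<lambda>\<tau>\<in>Ops \<Sigma>. \<lambda>t\<in>tuples (map (Term \<Sigma> S Y) (ins \<Sigma> \<tau>)). tuple [\<tau>, t])"

text \<open>A left adjoint of the forgetful functor, with its unit, lies strictly above the classical
  free algebra adjunction. The action on morphisms is determined by objects and unit.\<close>

definition lifts_term_algebra ::
    "('v, 'm) cat \<Rightarrow> ('v, 'm, 'u::zfc set, 'u \<Rightarrow> 'u) func \<Rightarrow> 'u set \<Rightarrow> ('u, 'v) enriched_signature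
      \<Rightarrow> ('u \<Rightarrow> 'v, 'u \<Rightarrow> 'm, ('u \<Rightarrow> 'v) \<times> ('u \<Rightarrow> 'm), 'u \<Rightarrow> 'm) func
      \<Rightarrow> (('u \<Rightarrow> 'v) \<Rightarrow> 'u \<Rightarrow> 'm) \<Rightarrow> bool"
  where "lifts_term_algebra V U S \<Sigma> F \<eta> \<longleftrightarrow> (\<forall>X\<in>Obj (pow_cat V S).
    underlying_algebra V U S \<Sigma> (Ob F X)
      = term_algebra (underlying_signature U \<Sigma>) S (Ob (pow_func U S) X)
    \<and> Ar (pow_func U S) X (Ob alg_forget (Ob F X)) (\<eta> X) = term_incl S (Ob (pow_func U S) X))"

definition term_carrier ::
    "('v, 'm, 'u::zfc set, 'u \<Rightarrow> 'u) func \<Rightarrow> 'u set \<Rightarrow> ('u, 'v) enriched_signature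
      \<Rightarrow> ('u \<Rightarrow> 'v) \<Rightarrow> 'u \<Rightarrow> 'u set"
  where "term_carrier U S \<Sigma> X = Term (underlying_signature U \<Sigma>) S (Ob (pow_func U S) X)"

definition sigma_hat ::
    "('v, 'm) cat \<Rightarrow> ('v, 'm, 'u::zfc set, 'u \<Rightarrow> 'u) func \<Rightarrow> ('u, 'v) enriched_signature
      \<Rightarrow> ('u \<Rightarrow> 'v) \<Rightarrow> 'u \<Rightarrow> 'u \<Rightarrow> 'u"
  where "sigma_hat V U \<Sigma> W \<sigma> =
    (\<lambda>z\<in>Ob U (arity_obj V U \<Sigma> W \<sigma>). tuple [tuple [\<sigma>, coord 0 z], coord 1 z])"

definition omega_sort ::
    "('v, 'm) cat \<Rightarrow> ('v, 'm, 'u::zfc set, 'u \<Rightarrow> 'u) func \<Rightarrow> 'u set \<Rightarrow> ('u, 'v) enriched_signature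
      \<Rightarrow> ('u \<Rightarrow> 'v) \<Rightarrow> ('u \<Rightarrow> 'v) \<Rightarrow> 'u \<Rightarrow> 'v"
  where "omega_sort V U S \<Sigma> X W s = final_structure set_cat V U (term_carrier U S \<Sigma> X s)
    {(arity_obj V U \<Sigma> W \<sigma>, sigma_hat V U \<Sigma> W \<sigma>) |\<sigma>. \<sigma> \<in> Ops \<Sigma> \<and> out \<Sigma> \<sigma> = s}"

primrec omega ::
    "('v, 'm) cat \<Rightarrow> ('v, 'm, 'u::zfc set, 'u \<Rightarrow> 'u) func \<Rightarrow> 'u set \<Rightarrow> ('u, 'v) enriched_signature
      \<Rightarrow> ('u \<Rightarrow> 'v) \<Rightarrow> nat \<Rightarrow> 'u \<Rightarrow> 'v" where
  "omega V U S \<Sigma> X 0 =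
    final_structure (pow_cat set_cat S) (pow_cat V S) (pow_func U S) (term_carrier U S \<Sigma> X)
      {(X, term_incl S (Ob (pow_func U S) X))}"
| "omega V U S \<Sigma> X (Suc n) =
    fib_sup (pow_cat set_cat S) (pow_cat V S) (pow_func U S) (term_carrier U S \<Sigma> X)
      {omega V U S \<Sigma> X n, \<lambda>s\<in>S. omega_sort V U S \<Sigma> X (omega V U S \<Sigma> X n) s}"

end

theory Submission
  imports Defs
begin

text \<open>Call a structure W over the sorted set of terms algebraic if the inclusion of generators and
  all term formation maps are admissible for W. The carrier of the free algebra is algebraic, and it
  is the least such structure, since the homomorphism to another one is the identity on terms. Every
  stage \<open>\<Omega>\<^sup>n(X)\<close> lies below each algebraic structure by induction on n. It remains to see that the
  supremum of the stages is algebraic: in a cartesian closed category finite products preserve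
  suprema of chains in fibres, so a term formation map is admissible on the supremum as soon as it
  is admissible on each stage, and it maps stage n into stage n + 1.\<close>

section \<open>Final lifts and powers of topological categories\<close>

text \<open>Cartesian closedness enters through currying: a map out of P x W becomes a map from W to
  an exponential, and a map out of a supremum can be tested on the stages. The exponential is an
  arbitrary object with an evaluation map, not a set of functions, so the curried maps of different
  stages have to be compared by uniqueness of transposes out of one common object. With several
  arguments only one factor is curried at a time, which leaves different indices in different
  factors; comparability of the stages brings them back to one index. For this step the supremum
  must be final against maps to arbitrary objects, not merely least in its fibre, so it is built as
  a final lift along identity functions. Forming lifts over the terms requires the terms of each
  sort to be a small set. That is read off from any structure in the fibre, which is why many lemmas
  carry a hypothesis \<open>W0 \<in> Fib\<close> for an arbitrary \<open>W0\<close>; the free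
  carrier or an upper bound under test can supply it.\<close>

context concrete_category
begin

lemma admissible_Hom:
  assumes "v \<in> Obj V" "w \<in> Obj V" "admissible V U v w f"
  shows "f \<in> Hom B (Ob U v) (Ob U w)"
  using assms Ar_Hom unfolding admissible_def by blast

lemma admissible_Idt:
  assumes "v \<in> Obj V"
  shows "admissible V U v v (Idt B (Ob U v))"
  using assms dom.Idt_Hom Ar_Idt unfolding admissible_def by (metis imageI)

lemma admissible_Cmp:
  assumes "v \<in> Obj V" "w \<in> Obj V" "z \<in> Obj V"
    and "admissible V U v w f" "admissible V U w z g"
  shows "admissible V U v z (Cmp B (Ob U v) (Ob U w) (Ob U z) g f)"
proof -
  from assms obtain f' g' where "f' \<in> Hom V v w" "f = Ar U v w f'"
    and "g' \<in> Hom V w z" "g = Ar U w z g'"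
    unfolding admissible_def by blast
  with assms dom.Cmp_Hom Ar_Cmp show ?thesis
    unfolding admissible_def by (metis imageI)
qed

text \<open>Finality is tested against the identity function on \<open>b\<close>, whose composites
  with the sink are the sink itself: the final lift is the least structure that admits the
  sink.\<close>

lemma is_final_lift_fib_le:
  assumes "b \<in> Obj B" "is_final_lift B V U b Snk v" "w \<in> fibre V U b"
    and snk: "\<And>u f. (u, f) \<in> Snk \<Longrightarrow> u \<in> Obj V \<and> f \<in> Hom B (Ob U u) b \<and> admissible V U u w f"
  shows "fib_le B V U b v w"
proof -
  have "Idt B b \<in> Hom B b (Ob U w)" and w: "w \<in> Obj V" "Ob U w = b"
    using assms by (auto simp: fibre_def cod.Idt_Hom)
  moreover have "Cmp B (Ob U u) b (Ob U w) (Idt B b) f = f" if "(u, f) \<in> Snk" for u f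
    using snk[OF that] w \<open>b \<in> Obj B\<close> Ob_Obj by (metis cod.Cmp_Idt_left)
  ultimately have "admissible V U v w (Idt B b)"
    using assms(2) snk unfolding is_final_lift_def by fastforce
  then show ?thesis
    using assms unfolding fib_le_def is_final_lift_def by blast
qed

end

context topological_category
begin

text \<open>Final lifts come from initial ones by the usual duality: \<open>b\<close> gets the
  initial structure for all maps out of \<open>b\<close> whose composites with the sink are
  admissible.\<close>

lemma final_lift_exists:
  assumes b: "b \<in> Obj B"
    and snk: "\<And>w f. (w, f) \<in> Snk \<Longrightarrow> w \<in> Obj V \<and> f \<in> Hom B (Ob U w) b"
  shows "\<exists>v. is_final_lift B V U b Snk v"
proof -
  \<comment> \<open>Ranges over all objects of \<open>V\<close>, so it may be a proper class;
    \<open>initial_lift\<close> covers such sources too.\<close>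
  define Src where "Src = {(z, g). z \<in> Obj V \<and> g \<in> Hom B b (Ob U z)
    \<and> (\<forall>(w, f)\<in>Snk. admissible V U w z (Cmp B (Ob U w) b (Ob U z) g f))}"
  have "structured_source B V U b Src"
    unfolding structured_source_def Src_def by auto
  then obtain v where v: "is_initial_lift B V U b Src v"
    using initial_lift b by blast
  have vO: "v \<in> Obj V" "Ob U v = b" "v \<in> fibre V U b"
    using v unfolding is_initial_lift_def fibre_def by auto
  have adm: "admissible V U w v f" if "(w, f) \<in> Snk" for w f
    using v snk[OF that] that unfolding is_initial_lift_def Src_def by fastforce
  have "admissible V U v z g \<longleftrightarrow>
      (\<forall>(w, f)\<in>Snk. admissible V U w z (Cmp B (Ob U w) b (Ob U z) g f))" (is "?l \<longleftrightarrow> ?r")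
    if "z \<in> Obj V" "g \<in> Hom B b (Ob U z)" for z g
  proof
    assume ?l
    then show ?r
      using admissible_Cmp[of _ v z] adm snk vO that by fastforce
  next
    assume ?r
    then have "(z, g) \<in> Src" using that unfolding Src_def by simp
    then show ?l using v unfolding is_initial_lift_def by blast
  qed
  then show ?thesis
    using vO adm unfolding is_final_lift_def by blast
qed

text \<open>The description by \<open>THE\<close> is sound because two final lifts of one sink lie
  below each other, and amnesticity identifies them.\<close>

lemma final_structure_is_final_lift:
  assumes b: "b \<in> Obj B"
    and snk: "\<And>w f. (w, f) \<in> Snk \<Longrightarrow> w \<in> Obj V \<and> f \<in> Hom B (Ob U w) b"
  shows "is_final_lift B V U b Snk (final_structure B V U b Snk)"
proof -
  obtain v where v: "is_final_lift B V U b Snk v"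
    using final_lift_exists[OF assms] by blast
  have le: "fib_le B V U b x y"
    if "is_final_lift B V U b Snk x" "is_final_lift B V U b Snk y" for x y
    using is_final_lift_fib_le[OF b that(1)] that(2) snk unfolding is_final_lift_def by blast
  show ?thesis
    unfolding final_structure_def
    by (rule theI[of _ v]) (use v le amnestic in blast)+
qed

text \<open>For a sink of identities, admissibility of the sink into \<open>w\<close> says that
  \<open>w\<close> is an upper bound.\<close>

lemma final_lift_is_fib_sup:
  assumes b: "b \<in> Obj B" and A: "A \<subseteq> fibre V U b"
    and v: "is_final_lift B V U b ((\<lambda>a. (a, Idt B b)) ` A) v"
  shows "is_fib_sup B V U b A v"
proof -
  have snk: "a \<in> Obj V \<and> Idt B b \<in> Hom B (Ob U a) b" if "a \<in> A" for a
    using A b that cod.Idt_Hom by (auto simp: fibre_def)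
  have "fib_le B V U b v w" if "w \<in> fibre V U b" "\<forall>a\<in>A. fib_le B V U b a w" for w
    using is_final_lift_fib_le[OF b v that(1)] that(2) snk by (auto simp: fib_le_def)
  then show ?thesis
    using v A unfolding is_fib_sup_def is_final_lift_def by (auto simp: fib_le_def)
qed

lemma fib_sup_is_fib_sup:
  assumes b: "b \<in> Obj B" and A: "A \<subseteq> fibre V U b"
  shows "is_fib_sup B V U b A (fib_sup B V U b A)"
proof -
  have "\<exists>v. is_final_lift B V U b ((\<lambda>a. (a, Idt B b)) ` A) v"
    by (rule final_lift_exists[OF b]) (use A b cod.Idt_Hom in \<open>auto simp: fibre_def\<close>)
  then obtain v where v: "is_fib_sup B V U b A v"
    using final_lift_is_fib_sup[OF b A] by blast
  show ?thesis
    unfolding fib_sup_def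
    by (rule theI[of _ v]) (use v amnestic in \<open>unfold is_fib_sup_def, blast\<close>)+
qed

end

section \<open>Sortwise powers of topological categories\<close>

lemma category_pow_cat:
  assumes "category C"
  shows "category (pow_cat C S)"
proof -
  interpret category C by fact
  show ?thesis
  proof
    fix X Y f
    assume *: "X \<in> Obj (pow_cat C S)" "Y \<in> Obj (pow_cat C S)" "f \<in> Hom (pow_cat C S) X Y"
    then show "Cmp (pow_cat C S) X X Y f (Idt (pow_cat C S) X) = f"
      by (auto simp: pow_cat_def PiE_iff Cmp_Idt_right intro!: extensionalityI[of _ S])
    show "Cmp (pow_cat C S) X Y Y (Idt (pow_cat C S) Y) f = f"
      using * by (auto simp: pow_cat_def PiE_iff Cmp_Idt_left intro!: extensionalityI[of _ S])
  qed (auto simp: pow_cat_def PiE_iff Idt_Hom Cmp_Hom Cmp_assoc)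
qed

lemma cat_functor_pow_func:
  assumes "cat_functor C D F"
  shows "cat_functor (pow_cat C S) (pow_cat D S) (pow_func F S)"
proof -
  interpret cat_functor C D F by fact
  interpret p: category "pow_cat C S" by (rule category_pow_cat) unfold_locales
  interpret q: category "pow_cat D S" by (rule category_pow_cat) unfold_locales
  show ?thesis
    by unfold_locales
      (auto simp: pow_cat_def pow_func_def PiE_iff Ob_Obj Ar_Hom Ar_Idt Ar_Cmp cong: restrict_cong)
qed

text \<open>Lifts are chosen sort by sort; extensionality of \<open>f\<close> makes it the image of
  the resulting family.\<close>

lemma admissible_pow_iff:
  assumes "v \<in> Obj (pow_cat V S)" "w \<in> Obj (pow_cat V S)" "f \<in> extensional S"
  shows "admissible (pow_cat V S) (pow_func U S) v w f
    \<longleftrightarrow> (\<forall>s\<in>S. admissible V U (v s) (w s) (f s))" (is "?l \<longleftrightarrow> ?r")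
proof
  assume ?l
  then show ?r by (auto simp: admissible_def pow_cat_def pow_func_def)
next
  assume ?r
  then have "\<forall>s\<in>S. \<exists>h. h \<in> Hom V (v s) (w s) \<and> f s = Ar U (v s) (w s) h"
    by (auto simp: admissible_def)
  then obtain h where h: "\<And>s. s \<in> S \<Longrightarrow> h s \<in> Hom V (v s) (w s) \<and> f s = Ar U (v s) (w s) (h s)"
    by metis
  have "f = Ar (pow_func U S) v w (restrict h S)"
    using assms h by (intro extensionalityI[of _ S]) (auto simp: pow_func_def)
  moreover have "restrict h S \<in> Hom (pow_cat V S) v w"
    using h by (auto simp: pow_cat_def)
  ultimately show ?l by (auto simp: admissible_def)
qed

lemma fibre_pow_iff:
  assumes "b \<in> extensional S"
  shows "v \<in> fibre (pow_cat V S) (pow_func U S) b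
    \<longleftrightarrow> v \<in> extensional S \<and> (\<forall>s\<in>S. v s \<in> fibre V U (b s))"
  using assms
  by (auto simp: fibre_def pow_cat_def pow_func_def PiE_iff intro!: extensionalityI[of _ S])

lemma fib_le_pow_iff:
  assumes "b \<in> extensional S"
  shows "fib_le (pow_cat B S) (pow_cat V S) (pow_func U S) b v w
    \<longleftrightarrow> v \<in> extensional S \<and> w \<in> extensional S \<and> (\<forall>s\<in>S. fib_le B V U (b s) (v s) (w s))"
proof (cases "v \<in> fibre (pow_cat V S) (pow_func U S) b \<and> w \<in> fibre (pow_cat V S) (pow_func U S) b")
  case True
  then have "v \<in> Obj (pow_cat V S)" "w \<in> Obj (pow_cat V S)" by (auto simp: fibre_def)
  from admissible_pow_iff[OF this, of "Idt (pow_cat B S) b"] True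
  show ?thesis
    unfolding fib_le_def fibre_pow_iff[OF assms] by (auto simp: pow_cat_def)
next
  case False
  then show ?thesis
    unfolding fib_le_def fibre_pow_iff[OF assms] by auto
qed

lemma topological_category_pow:
  assumes "topological_category V B U"
  shows "topological_category (pow_cat V S) (pow_cat B S) (pow_func U S)"
proof -
  interpret topological_category V B U by fact
  interpret p: cat_functor "pow_cat V S" "pow_cat B S" "pow_func U S"
    by (rule cat_functor_pow_func) unfold_locales
  have ext: "b \<in> extensional S" if "b \<in> Obj (pow_cat B S)" for b
    using that by (simp add: pow_cat_def PiE_iff)
  show ?thesis
  proof
    fix v w
    assume vw: "v \<in> Obj (pow_cat V S)" "w \<in> Obj (pow_cat V S)"
    show "inj_on (Ar (pow_func U S) v w) (Hom (pow_cat V S) v w)"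
    proof (rule inj_onI, rule extensionalityI[of _ S])
      fix f g s
      assume fg: "f \<in> Hom (pow_cat V S) v w" "g \<in> Hom (pow_cat V S) v w"
        and eq: "Ar (pow_func U S) v w f = Ar (pow_func U S) v w g" and "s \<in> S"
      have "Ar U (v s) (w s) (f s) = Ar U (v s) (w s) (g s)"
        using fun_cong[OF eq, of s] \<open>s \<in> S\<close> by (simp add: pow_func_def)
      then show "f s = g s"
        using vw fg \<open>s \<in> S\<close> faithful[of "v s" "w s"]
        by (intro inj_onD[of "Ar U (v s) (w s)" "Hom V (v s) (w s)"]) (auto simp: pow_cat_def)
    qed (auto simp: pow_cat_def PiE_iff)
  next
    fix b v w
    assume *: "fib_le (pow_cat B S) (pow_cat V S) (pow_func U S) b v w"
      "fib_le (pow_cat B S) (pow_cat V S) (pow_func U S) b w v"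
    then have "b \<in> extensional S" by (auto simp: fib_le_def fibre_def pow_func_def)
    from * show "v = w"
      unfolding fib_le_pow_iff[OF \<open>b \<in> extensional S\<close>]
      using amnestic by (intro extensionalityI[of _ S]) auto
  next
    fix b Src
    assume b: "b \<in> Obj (pow_cat B S)"
      and src: "structured_source (pow_cat B S) (pow_cat V S) (pow_func U S) b Src"
    have src': "w \<in> Obj (pow_cat V S) \<and> f \<in> extensional S
        \<and> (\<forall>s\<in>S. w s \<in> Obj V \<and> f s \<in> Hom B (b s) (Ob U (w s)))" if "(w, f) \<in> Src" for w f
      using src that by (fastforce simp: structured_source_def pow_cat_def pow_func_def PiE_iff)
    \<comment> \<open>The source at sort \<open>s\<close> is the image of \<open>Src\<close> under
      evaluation at \<open>s\<close>; the initial lifts at all sorts are collected into one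
      family.\<close>
    have "\<forall>s\<in>S. \<exists>v. is_initial_lift B V U (b s) ((\<lambda>(w, f). (w s, f s)) ` Src) v"
      using b src' by (intro ballI initial_lift) (auto simp: structured_source_def pow_cat_def)
    then obtain v0 where v0: "\<And>s. s \<in> S \<Longrightarrow>
        is_initial_lift B V U (b s) ((\<lambda>(w, f). (w s, f s)) ` Src) (v0 s)"
      by metis
    define v where "v = restrict v0 S"
    have v: "is_initial_lift B V U (b s) ((\<lambda>(w, f). (w s, f s)) ` Src) (v s)" if "s \<in> S" for s
      using v0 that by (simp add: v_def)
    have vf: "v \<in> fibre (pow_cat V S) (pow_func U S) b"
      using v unfolding fibre_pow_iff[OF ext[OF b]] by (auto simp: v_def is_initial_lift_def)
    then have vO: "v \<in> Obj (pow_cat V S)" by (simp add: fibre_def)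
    have adm: "admissible (pow_cat V S) (pow_func U S) v w f" if "(w, f) \<in> Src" for w f
    proof -
      have "admissible V U (v s) (w s) (f s)" if "s \<in> S" for s
        using v[OF that] \<open>(w, f) \<in> Src\<close> by (force simp: is_initial_lift_def)
      then show ?thesis
        using src'[OF that] vO by (simp add: admissible_pow_iff)
    qed
    have "admissible (pow_cat V S) (pow_func U S) z v g \<longleftrightarrow>
        (\<forall>(w, f)\<in>Src. admissible (pow_cat V S) (pow_func U S) z w
          (Cmp (pow_cat B S) (Ob (pow_func U S) z) b (Ob (pow_func U S) w) f g))"
      if z: "z \<in> Obj (pow_cat V S)" and g: "g \<in> Hom (pow_cat B S) (Ob (pow_func U S) z) b" for z g
    proof -
      have "admissible (pow_cat V S) (pow_func U S) z v g
          \<longleftrightarrow> (\<forall>s\<in>S. admissible V U (z s) (v s) (g s))"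
        using z vO g by (intro admissible_pow_iff) (auto simp: pow_cat_def PiE_iff)
      also have "\<dots> \<longleftrightarrow> (\<forall>s\<in>S. \<forall>(w, f)\<in>Src. admissible V U (z s) (w s)
          (Cmp B (Ob U (z s)) (b s) (Ob U (w s)) (f s) (g s)))"
      proof (rule ball_cong[OF refl])
        fix s
        assume "s \<in> S"
        then have "z s \<in> Obj V" "g s \<in> Hom B (Ob U (z s)) (b s)"
          using z g by (auto simp: pow_cat_def pow_func_def PiE_iff)
        with v[OF \<open>s \<in> S\<close>]
        show "admissible V U (z s) (v s) (g s) \<longleftrightarrow> (\<forall>(w, f)\<in>Src. admissible V U (z s) (w s)
          (Cmp B (Ob U (z s)) (b s) (Ob U (w s)) (f s) (g s)))"
          by (auto simp: is_initial_lift_def)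
      qed
      also have "\<dots> \<longleftrightarrow> (\<forall>(w, f)\<in>Src. admissible (pow_cat V S) (pow_func U S) z w
          (Cmp (pow_cat B S) (Ob (pow_func U S) z) b (Ob (pow_func U S) w) f g))"
      proof -
        have "admissible (pow_cat V S) (pow_func U S) z w
            (Cmp (pow_cat B S) (Ob (pow_func U S) z) b (Ob (pow_func U S) w) f g)
          \<longleftrightarrow> (\<forall>s\<in>S. admissible V U (z s) (w s)
            (Cmp B (Ob U (z s)) (b s) (Ob U (w s)) (f s) (g s)))" if "(w, f) \<in> Src" for w f
          using src'[OF that] z
          by (subst admissible_pow_iff) (auto simp: pow_cat_def pow_func_def)
        then show ?thesis by fast
      qed
      finally show ?thesis .
    qed
    then have "is_initial_lift (pow_cat B S) (pow_cat V S) (pow_func U S) b Src v"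
      using vf adm unfolding is_initial_lift_def by blast
    then show "\<exists>v. is_initial_lift (pow_cat B S) (pow_cat V S) (pow_func U S) b Src v" by blast
  qed
qed

section \<open>Tuples\<close>

lemma elts_mkset: "small A \<Longrightarrow> elts (mkset A) = A"
  by (simp add: small_def mkset_def f_inv_into_f)

lemma small_subset: "small B \<Longrightarrow> A \<subseteq> B \<Longrightarrow> small A"
  by (auto simp: small_def intro: elts_subset)

lemma small_image: "small A \<Longrightarrow> small (f ` A)" for f :: "'u::zfc \<Rightarrow> 'u"
  by (auto simp: small_def intro: elts_replacement)

lemma small_UN:
  fixes B :: "'u::zfc \<Rightarrow> 'u set"
  assumes "small A" "\<And>x. x \<in> A \<Longrightarrow> small (B x)"
  shows "small (\<Union>x\<in>A. B x)"
proof -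
  have "(\<Union>x\<in>A. B x) = (\<Union>y\<in>elts (mkset ((\<lambda>x. mkset (B x)) ` A)). elts y)"
    using assms by (simp add: elts_mkset small_image)
  then show ?thesis
    unfolding small_def by (simp only: elts_Union)
qed

text \<open>Pairing comes out of \<open>elts_infinity\<close>, which makes the range of every
  sequence small; a sequence with the two values \<open>x\<close> and \<open>y\<close> gives the
  doubleton.\<close>

lemma small_doubleton: "small {x, y :: 'u::zfc}"
proof -
  have "{x, y} = range (\<lambda>n::nat. if n = 0 then x else y)" by auto
  then show ?thesis
    unfolding small_def by (metis elts_infinity)
qed

lemma small_singleton: "small {x :: 'u::zfc}"
  using small_doubleton[of x x] by simp

lemma small_empty: "small {}"
  by (rule small_subset[OF small_singleton]) simp

lemma mkset_inject: "small A \<Longrightarrow> small B \<Longrightarrow> mkset A = mkset B \<longleftrightarrow> A = B"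
  by (metis elts_mkset)

lemma kpair_inject: "kpair x y = kpair x' y' \<longleftrightarrow> x = x' \<and> y = y'"
  by (auto simp: kpair_def mkset_inject small_doubleton small_singleton doubleton_eq_iff)

lemma kpair_not_empty: "kpair x y \<noteq> mkset {}"
  by (simp add: kpair_def mkset_inject small_doubleton small_empty)

lemma inj_tuple: "inj tuple"
proof (rule injI)
  fix xs ys :: "'a list"
  assume "tuple xs = tuple ys"
  then show "xs = ys"
  proof (induction xs arbitrary: ys)
    case Nil
    then show ?case by (cases ys) (auto simp: kpair_not_empty kpair_not_empty[symmetric])
  next
    case (Cons x xs)
    then show ?case by (cases ys) (auto simp: kpair_inject kpair_not_empty)
  qed
qed

lemma tuple_inject [simp]: "tuple xs = tuple ys \<longleftrightarrow> xs = ys"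
  using inj_tuple by (auto dest: injD)

declare tuple.simps [simp del]

lemma coord_tuple [simp]: "coord i (tuple xs) = xs ! i"
  by (simp add: coord_def inj_tuple)

lemma tuple_in_tuples: "tuple xs \<in> tuples As \<longleftrightarrow> list_all2 (\<in>) xs As"
  by (auto simp: tuples_def)

lemma tuplesE:
  assumes "z \<in> tuples As"
  obtains xs where "z = tuple xs" "length xs = length As" "\<And>i. i < length As \<Longrightarrow> xs ! i \<in> As ! i"
  using assms by (auto simp: tuples_def list_all2_conv_all_nth)

lemma tuples_Nil: "tuples [] = {tuple []}"
  by (auto simp: tuples_def)

text \<open>Recursion along the list of factors; it reduces smallness of finite products to unions
  and replacement.\<close>

lemma tuples_Cons: "tuples (A # As) = (\<Union>x\<in>A. kpair x ` tuples As)"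
  by (force simp: tuples_def list_all2_Cons2 tuple.simps)

lemma tuples_eqI:
  assumes "y \<in> tuples As" "z \<in> tuples As" "\<And>i. i < length As \<Longrightarrow> coord i y = coord i z"
  shows "y = z"
  using assms by (auto elim!: tuplesE intro!: nth_equalityI)

lemma tuples_pair: "z \<in> tuples [A, B] \<longleftrightarrow> (\<exists>x\<in>A. \<exists>y\<in>B. z = tuple [x, y])"
  by (auto simp: tuples_def list_all2_Cons2)

lemma coord_in: "z \<in> tuples As \<Longrightarrow> i < length As \<Longrightarrow> coord i z \<in> As ! i"
  by (auto elim!: tuplesE)

lemma small_tuples: "(\<And>A. A \<in> set As \<Longrightarrow> small A) \<Longrightarrow> small (tuples As)"
  by (induction As) (auto simp: tuples_Nil tuples_Cons small_singleton intro!: small_UN small_image)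

text \<open>The projection of a product over \<open>v # Vs\<close> onto the product over
  \<open>Vs\<close>. Its counterpart is \<open>kpair\<close>, which prepends an entry to a coded
  tuple.\<close>

definition tuple_tl :: "'u::zfc \<Rightarrow> 'u"
  where "tuple_tl z = tuple (tl (inv tuple z))"

lemma tuple_tl_tuple [simp]: "tuple_tl (tuple xs) = tuple (tl xs)"
  by (simp add: tuple_tl_def inj_tuple)

section \<open>Admissible functions and products over sets\<close>

locale topological_set_category = topological_category V set_cat U
  for V :: "('v, 'm) cat" and U :: "('v, 'm, 'u::zfc set, 'u \<Rightarrow> 'u) func"
begin

text \<open>Only the values of f on the underlying set of v matter, so underlying maps compose as plain
  HOL functions.\<close>

definition adm :: "'v \<Rightarrow> 'v \<Rightarrow> ('u \<Rightarrow> 'u) \<Rightarrow> bool"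
  where "adm v w f \<longleftrightarrow> v \<in> Obj V \<and> w \<in> Obj V \<and> admissible V U v w (restrict f (Ob U v))"

text \<open>By faithfulness the lift is unique, so \<open>SOME\<close> leaves no real choice; the
  value is meaningful when \<open>adm v w f\<close> holds.\<close>

definition arrow :: "'v \<Rightarrow> 'v \<Rightarrow> ('u \<Rightarrow> 'u) \<Rightarrow> 'm"
  where "arrow v w f = (SOME h. h \<in> Hom V v w \<and> Ar U v w h = restrict f (Ob U v))"

lemma adm_Obj: "adm v w f \<Longrightarrow> v \<in> Obj V" "adm v w f \<Longrightarrow> w \<in> Obj V"
  by (auto simp: adm_def)

lemma adm_cong: "(\<And>x. x \<in> Ob U v \<Longrightarrow> f x = g x) \<Longrightarrow> adm v w f \<longleftrightarrow> adm v w g"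
  by (simp add: adm_def cong: restrict_cong)

lemma adm_eq: "adm v w f \<Longrightarrow> (\<And>x. x \<in> Ob U v \<Longrightarrow> f x = g x) \<Longrightarrow> adm v w g"
  using adm_cong by blast

lemma Ar_extensional:
  assumes "v \<in> Obj V" "w \<in> Obj V" "h \<in> Hom V v w"
  shows "Ar U v w h \<in> Ob U v \<rightarrow>\<^sub>E Ob U w"
  using Ar_Hom[OF assms] by (simp add: set_cat_def)

lemma admissible_iff_adm:
  assumes "v \<in> Obj V" "w \<in> Obj V" "f \<in> extensional (Ob U v)"
  shows "admissible V U v w f \<longleftrightarrow> adm v w f"
  using assms by (simp add: adm_def extensional_restrict)

lemma adm_Ar:
  assumes "v \<in> Obj V" "w \<in> Obj V" "h \<in> Hom V v w"
  shows "adm v w (Ar U v w h)"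
  using assms Ar_extensional[OF assms]
  by (subst admissible_iff_adm[symmetric]) (auto simp: admissible_def PiE_iff)

lemma arrow:
  assumes "adm v w f"
  shows "arrow v w f \<in> Hom V v w" "Ar U v w (arrow v w f) = restrict f (Ob U v)"
proof -
  have "\<exists>h. h \<in> Hom V v w \<and> Ar U v w h = restrict f (Ob U v)"
    using assms by (auto simp: adm_def admissible_def)
  from someI_ex[OF this] show "arrow v w f \<in> Hom V v w"
    "Ar U v w (arrow v w f) = restrict f (Ob U v)"
    by (auto simp: arrow_def)
qed

lemma adm_in: "adm v w f \<Longrightarrow> x \<in> Ob U v \<Longrightarrow> f x \<in> Ob U w"
  using admissible_Hom[of v w "restrict f (Ob U v)"]
  by (auto simp: adm_def set_cat_def PiE_iff)

lemma adm_id: "v \<in> Obj V \<Longrightarrow> adm v v (\<lambda>x. x)"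
  using admissible_Idt[of v] by (simp add: adm_def set_cat_def)

lemma adm_comp:
  assumes "adm v w f" "adm w z g"
  shows "adm v z (\<lambda>x. g (f x))"
proof -
  have "compose (Ob U v) (restrict g (Ob U w)) (restrict f (Ob U v))
      = restrict (\<lambda>x. g (f x)) (Ob U v)"
    using adm_in[OF assms(1)] by (auto simp: compose_def)
  then show ?thesis
    using assms admissible_Cmp[of v w z "restrict f (Ob U v)" "restrict g (Ob U w)"]
    by (simp add: adm_def set_cat_def)
qed

text \<open>Faithfulness in pointwise form, used to prove equations between morphisms by computing
  underlying functions.\<close>

lemma Hom_eqI:
  assumes "v \<in> Obj V" "w \<in> Obj V" "h \<in> Hom V v w" "k \<in> Hom V v w"
    and "\<And>x. x \<in> Ob U v \<Longrightarrow> Ar U v w h x = Ar U v w k x"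
  shows "h = k"
proof -
  have "Ar U v w h = Ar U v w k"
    using Ar_extensional assms by (intro extensionalityI[of _ "Ob U v"]) (auto simp: PiE_iff)
  then show ?thesis
    using faithful[of v w] assms by (auto dest: inj_onD)
qed

lemma Ar_Cmp_apply:
  assumes "v \<in> Obj V" "w \<in> Obj V" "z \<in> Obj V" "f \<in> Hom V v w" "g \<in> Hom V w z" "x \<in> Ob U v"
  shows "Ar U v z (Cmp V v w z g f) x = Ar U w z g (Ar U v w f x)"
  using assms by (simp add: Ar_Cmp set_cat_def compose_def)

lemma fib_le_iff_adm:
  "fib_le set_cat V U b v w \<longleftrightarrow> v \<in> fibre V U b \<and> w \<in> fibre V U b \<and> adm v w (\<lambda>x. x)"
  by (auto simp: fib_le_def fibre_def adm_def set_cat_def)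

text \<open>The restrictions hidden in \<open>adm\<close> are reconciled with
  \<open>compose\<close>, which works because the sink maps into \<open>b\<close>. This gives
  finality for plain functions \<open>g\<close>.\<close>

lemma final_lift_adm_iff:
  assumes "is_final_lift set_cat V U b Snk v" "z \<in> Obj V" "g \<in> b \<rightarrow> Ob U z"
    and snk: "\<And>w f. (w, f) \<in> Snk \<Longrightarrow> w \<in> Obj V \<and> f \<in> Ob U w \<rightarrow> b"
  shows "adm v z g \<longleftrightarrow> (\<forall>(w, f)\<in>Snk. adm w z (\<lambda>x. g (f x)))"
proof -
  have v: "v \<in> Obj V" "Ob U v = b"
    using assms by (auto simp: is_final_lift_def fibre_def)
  have "admissible V U v z (restrict g b) \<longleftrightarrow> (\<forall>(w, f)\<in>Snk. admissible V U w z
      (Cmp set_cat (Ob U w) b (Ob U z) (restrict g b) f))"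
    using assms v unfolding is_final_lift_def by (auto simp: set_cat_def)
  also have "\<dots> \<longleftrightarrow> (\<forall>(w, f)\<in>Snk. adm w z (\<lambda>x. g (f x)))"
  proof -
    have "Cmp set_cat (Ob U w) b (Ob U z) (restrict g b) f = restrict (\<lambda>x. g (f x)) (Ob U w)"
      if "(w, f) \<in> Snk" for w f
      using snk[OF that] by (auto simp: set_cat_def compose_def intro!: restrict_ext)
    then show ?thesis
      using snk \<open>z \<in> Obj V\<close> by (fastforce simp: adm_def)
  qed
  finally show ?thesis
    using v \<open>z \<in> Obj V\<close> by (simp add: adm_def)
qed

section \<open>Finite products with sets of tuples as underlying sets\<close>

lemma small_Ob: "v \<in> Obj V \<Longrightarrow> small (Ob U v)"
  using Ob_Obj by (simp add: set_cat_def)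

lemma small_carrier: "set Vs \<subseteq> Obj V \<Longrightarrow> small (tuples (map (Ob U) Vs))"
  by (rule small_tuples) (auto simp: small_Ob)

text \<open>A strict product carries the initial structure for its coordinate functions: the
  universal property yields a lift, whose underlying function is \<open>g\<close> because a tuple is
  determined by its coordinates.\<close>

lemma strict_product_adm_iff:
  assumes P: "is_strict_product V U Vs Q \<pi>" and Vs: "set Vs \<subseteq> Obj V"
  shows "adm z Q g \<longleftrightarrow> z \<in> Obj V \<and> g \<in> Ob U z \<rightarrow> tuples (map (Ob U) Vs)
    \<and> (\<forall>i<length Vs. adm z (Vs ! i) (\<lambda>x. coord i (g x)))" (is "?l \<longleftrightarrow> ?r")
proof -
  have Q: "Q \<in> Obj V" "Ob U Q = tuples (map (Ob U) Vs)"
    and \<pi>: "\<And>i. i < length Vs \<Longrightarrow> \<pi> i \<in> Hom V Q (Vs ! i)"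
    "\<And>i. i < length Vs \<Longrightarrow> Ar U Q (Vs ! i) (\<pi> i) = (\<lambda>z\<in>Ob U Q. coord i z)"
    using P by (auto simp: is_strict_product_def is_product_def)
  have \<pi>_adm: "adm Q (Vs ! i) (coord i)" if "i < length Vs" for i
  proof -
    have "adm Q (Vs ! i) (Ar U Q (Vs ! i) (\<pi> i))"
      using that Vs by (intro adm_Ar Q \<pi>) auto
    then show ?thesis
      by (simp add: \<pi>(2)[OF that] adm_def)
  qed
  show ?thesis
  proof
    assume ?l
    then show ?r
      using adm_in[OF \<open>?l\<close>] adm_comp[OF \<open>?l\<close> \<pi>_adm] Q by (auto dest: adm_Obj)
  next
    assume r: ?r
    define f where "f = (\<lambda>i. arrow z (Vs ! i) (\<lambda>x. coord i (g x)))"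
    have f: "f i \<in> Hom V z (Vs ! i)"
      "Ar U z (Vs ! i) (f i) = (\<lambda>x\<in>Ob U z. coord i (g x))" if "i < length Vs" for i
      using r that arrow[of z "Vs ! i"] unfolding f_def by blast+
    then obtain h where h: "h \<in> Hom V z Q"
      "\<And>i. i < length Vs \<Longrightarrow> Cmp V z Q (Vs ! i) (\<pi> i) h = f i"
      using P r unfolding is_strict_product_def is_product_def by metis
    have "Ar U z Q h x = g x" if x: "x \<in> Ob U z" for x
    proof (rule tuples_eqI)
      show hx: "Ar U z Q h x \<in> tuples (map (Ob U) Vs)"
        using Ar_extensional[of z Q h] r Q h x by auto
      show "g x \<in> tuples (map (Ob U) Vs)" using r x by auto
      fix i
      assume "i < length (map (Ob U) Vs)"
      then have i: "i < length Vs" by simp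
      have "coord i (Ar U z Q h x) = Ar U Q (Vs ! i) (\<pi> i) (Ar U z Q h x)"
        using hx Q by (simp add: \<pi>(2)[OF i])
      also have "\<dots> = Ar U z (Vs ! i) (f i) x"
        using Ar_Cmp_apply[of z Q "Vs ! i" h "\<pi> i" x] r Q Vs h(1) h(2)[OF i] i x \<pi>(1)[OF i]
        by (metis nth_mem subsetD)
      finally show "coord i (Ar U z Q h x) = coord i (g x)" using f[OF i] x by simp
    qed
    then show ?l
      using adm_Ar[of z Q h] adm_cong[of z "Ar U z Q h" g Q] r Q h by blast
  qed
qed

text \<open>The initial structure for the coordinate functions on the set of tuples is a product:
  tupling of admissible functions stays admissible, and faithfulness gives uniqueness.\<close>

lemma strict_product_exists:
  assumes Vs: "set Vs \<subseteq> Obj V"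
  shows "\<exists>Q \<pi>. is_strict_product V U Vs Q \<pi>"
proof -
  let ?b = "tuples (map (Ob U) Vs)"
  define Src where "Src = {(Vs ! i, \<lambda>z\<in>?b. coord i z) |i. i < length Vs}"
  have coord: "(\<lambda>z\<in>?b. coord i z) \<in> ?b \<rightarrow> Ob U (Vs ! i)" if "i < length Vs" for i
    using that by (auto dest: coord_in)
  have "?b \<in> Obj set_cat" using small_carrier[OF Vs] by (simp add: set_cat_def)
  moreover have "structured_source set_cat V U ?b Src"
    using Vs coord by (fastforce simp: structured_source_def Src_def set_cat_def)
  ultimately obtain Q where Q: "is_initial_lift set_cat V U ?b Src Q"
    using initial_lift by blast
  then have QO: "Q \<in> Obj V" "Ob U Q = ?b"
    by (auto simp: is_initial_lift_def fibre_def)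
  have pr: "adm Q (Vs ! i) (coord i)" if "i < length Vs" for i
  proof -
    have "(Vs ! i, \<lambda>z\<in>?b. coord i z) \<in> Src" using that by (auto simp: Src_def)
    then have "admissible V U Q (Vs ! i) (\<lambda>z\<in>?b. coord i z)"
      using Q unfolding is_initial_lift_def by blast
    then show ?thesis using QO Vs that by (auto simp: adm_def)
  qed
  have adm_into: "adm z Q g" if z: "z \<in> Obj V" and g: "g \<in> Ob U z \<rightarrow> ?b"
    and gi: "\<And>i. i < length Vs \<Longrightarrow> adm z (Vs ! i) (\<lambda>x. coord i (g x))" for z g
  proof -
    have "Cmp set_cat (Ob U z) ?b (Ob U (Vs ! i)) (\<lambda>z\<in>?b. coord i z) (restrict g (Ob U z))
        = (\<lambda>x\<in>Ob U z. coord i (g x))" for i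
      using g by (auto simp: set_cat_def compose_def intro!: restrict_ext)
    then have "\<forall>(w, f)\<in>Src. admissible V U z w
        (Cmp set_cat (Ob U z) ?b (Ob U w) f (restrict g (Ob U z)))"
      using gi by (auto simp: Src_def adm_def)
    moreover have "restrict g (Ob U z) \<in> Hom set_cat (Ob U z) ?b"
      using g by (auto simp: set_cat_def)
    ultimately show ?thesis
      using Q z QO unfolding adm_def is_initial_lift_def by blast
  qed
  define \<pi> where "\<pi> = (\<lambda>i. arrow Q (Vs ! i) (coord i))"
  have \<pi>: "\<pi> i \<in> Hom V Q (Vs ! i)" "Ar U Q (Vs ! i) (\<pi> i) = (\<lambda>z\<in>Ob U Q. coord i z)"
    if "i < length Vs" for i
    using arrow[OF pr[OF that]] by (auto simp: \<pi>_def)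
  have "\<exists>!h. h \<in> Hom V z Q \<and> (\<forall>i<length Vs. Cmp V z Q (Vs ! i) (\<pi> i) h = f i)"
    if z: "z \<in> Obj V" and f: "\<And>i. i < length Vs \<Longrightarrow> f i \<in> Hom V z (Vs ! i)" for z f
  proof -
    \<comment> \<open>The underlying function of the mediating morphism is forced by its
      coordinates.\<close>
    define g where "g = (\<lambda>x. tuple (map (\<lambda>i. Ar U z (Vs ! i) (f i) x) [0..<length Vs]))"
    have fi: "Ar U z (Vs ! i) (f i) \<in> Ob U z \<rightarrow>\<^sub>E Ob U (Vs ! i)" if "i < length Vs" for i
      using that Vs z f by (intro Ar_extensional) auto
    have "adm z Q g"
    proof (rule adm_into[OF z])
      show "g \<in> Ob U z \<rightarrow> ?b"
        using PiE_mem[OF fi] by (auto simp: g_def tuple_in_tuples list_all2_conv_all_nth)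
      show "adm z (Vs ! i) (\<lambda>x. coord i (g x))" if "i < length Vs" for i
        using that adm_Ar[OF z _ f[OF that]] subsetD[OF Vs nth_mem[OF that]] by (simp add: g_def)
    qed
    note h = arrow[OF this]
    have comp: "Ar U z (Vs ! i) (Cmp V z Q (Vs ! i) (\<pi> i) k) x = coord i (Ar U z Q k x)"
      if "i < length Vs" "k \<in> Hom V z Q" "x \<in> Ob U z" for i k x
    proof -
      have "Ar U z Q k x \<in> Ob U Q" using Ar_extensional[of z Q k] that z QO by auto
      then show ?thesis
        using that Vs z QO \<pi>[of i] by (subst Ar_Cmp_apply) auto
    qed
    show ?thesis
    proof (rule ex1I[of _ "arrow z Q g"], intro conjI allI impI)
      show "arrow z Q g \<in> Hom V z Q" by (rule h)
      fix i
      assume i: "i < length Vs"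
      then have Vi: "Vs ! i \<in> Obj V" using Vs by auto
      show "Cmp V z Q (Vs ! i) (\<pi> i) (arrow z Q g) = f i"
      proof (rule Hom_eqI[OF z Vi])
        show "Cmp V z Q (Vs ! i) (\<pi> i) (arrow z Q g) \<in> Hom V z (Vs ! i)"
          using z QO Vi h \<pi> i by (intro dom.Cmp_Hom) auto
        show "Ar U z (Vs ! i) (Cmp V z Q (Vs ! i) (\<pi> i) (arrow z Q g)) x = Ar U z (Vs ! i) (f i) x"
          if "x \<in> Ob U z" for x
          using that i by (simp add: comp h) (simp add: g_def)
      qed (rule f[OF i])
    next
      fix k
      assume k: "k \<in> Hom V z Q \<and> (\<forall>i<length Vs. Cmp V z Q (Vs ! i) (\<pi> i) k = f i)"
      show "k = arrow z Q g"
      proof (rule Hom_eqI[OF z QO(1)])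
        fix x
        assume x: "x \<in> Ob U z"
        have "Ar U z Q k x = g x"
        proof (rule tuples_eqI)
          show "Ar U z Q k x \<in> ?b" using Ar_extensional[of z Q k] k x z QO by auto
          show "g x \<in> ?b" using adm_in[OF \<open>adm z Q g\<close> x] QO by simp
          show "coord i (Ar U z Q k x) = coord i (g x)" if "i < length (map (Ob U) Vs)" for i
            using comp[of i k x] that k x by (auto simp: g_def)
        qed
        then show "Ar U z Q k x = Ar U z Q (arrow z Q g) x" using h x by simp
      qed (use k h in auto)
    qed
  qed
  then have "is_strict_product V U Vs Q \<pi>"
    using QO \<pi> unfolding is_strict_product_def is_product_def by blast
  then show ?thesis by blast
qed

text \<open>Strict products of one list share their underlying set and their initial structure, so
  the identity is admissible both ways and amnesticity makes them equal.\<close>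

lemma prod_obj_strict_product:
  assumes Vs: "set Vs \<subseteq> Obj V"
  shows "\<exists>\<pi>. is_strict_product V U Vs (prod_obj V U Vs) \<pi>"
proof -
  let ?P = "\<lambda>Q. \<exists>\<pi>. is_strict_product V U Vs Q \<pi>"
  have le: "fib_le set_cat V U (tuples (map (Ob U) Vs)) Q Q'" if "?P Q" "?P Q'" for Q Q'
  proof -
    from that obtain \<pi> \<pi>' where Q: "is_strict_product V U Vs Q \<pi>"
      and Q': "is_strict_product V U Vs Q' \<pi>'" by blast
    have "Q \<in> Obj V" "Q' \<in> Obj V" "Ob U Q = tuples (map (Ob U) Vs)"
      "Ob U Q' = tuples (map (Ob U) Vs)"
      using Q Q' by (auto simp: is_strict_product_def is_product_def)
    moreover have "adm Q Q' (\<lambda>x. x)"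
      using adm_id[OF \<open>Q \<in> Obj V\<close>]
      by (simp add: strict_product_adm_iff[OF Q Vs] strict_product_adm_iff[OF Q' Vs])
    ultimately show ?thesis by (simp add: fib_le_iff_adm fibre_def)
  qed
  obtain Q where "?P Q" using strict_product_exists[OF Vs] by blast
  then show ?thesis
    unfolding prod_obj_def by (rule theI) (use le \<open>?P Q\<close> amnestic in blast)
qed

lemma
  assumes "set Vs \<subseteq> Obj V"
  shows prod_obj_Obj: "prod_obj V U Vs \<in> Obj V"
    and Ob_prod_obj: "Ob U (prod_obj V U Vs) = tuples (map (Ob U) Vs)"
  using prod_obj_strict_product[OF assms] by (auto simp: is_strict_product_def is_product_def)

lemma adm_prod_obj_iff:
  assumes "set Vs \<subseteq> Obj V"
  shows "adm z (prod_obj V U Vs) g \<longleftrightarrow> z \<in> Obj V \<and> g \<in> Ob U z \<rightarrow> tuples (map (Ob U) Vs)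
    \<and> (\<forall>i<length Vs. adm z (Vs ! i) (\<lambda>x. coord i (g x)))"
  using prod_obj_strict_product[OF assms] strict_product_adm_iff[OF _ assms] by blast

lemma adm_coord:
  assumes "set Vs \<subseteq> Obj V" "i < length Vs"
  shows "adm (prod_obj V U Vs) (Vs ! i) (coord i)"
  using adm_id[OF prod_obj_Obj[OF assms(1)]] assms(2) unfolding adm_prod_obj_iff[OF assms(1)] by blast

lemma adm_tuple:
  assumes "length fs = length Vs" "\<And>i. i < length Vs \<Longrightarrow> adm z (Vs ! i) (fs ! i)" "z \<in> Obj V"
  shows "adm z (prod_obj V U Vs) (\<lambda>x. tuple (map (\<lambda>f. f x) fs))"
proof -
  have "set Vs \<subseteq> Obj V" using adm_Obj(2)[OF assms(2)] by (auto simp: in_set_conv_nth)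
  then show ?thesis
    using assms adm_in[OF assms(2)]
    by (auto simp: adm_prod_obj_iff tuple_in_tuples list_all2_conv_all_nth)
qed

lemma adm_pair:
  assumes "adm z v f" "adm z w g"
  shows "adm z (prod_obj V U [v, w]) (\<lambda>x. tuple [f x, g x])"
proof -
  have "adm z ([v, w] ! i) ([f, g] ! i)" if "i < length [v, w]" for i
    using that assms by (auto simp: less_Suc_eq)
  from adm_tuple[OF _ this] show ?thesis
    using adm_Obj(1)[OF assms(1)] by simp
qed

lemma adm_fst: "v \<in> Obj V \<Longrightarrow> w \<in> Obj V \<Longrightarrow> adm (prod_obj V U [v, w]) v (coord 0)"
  using adm_coord[of "[v, w]" 0] by simp

lemma adm_snd: "v \<in> Obj V \<Longrightarrow> w \<in> Obj V \<Longrightarrow> adm (prod_obj V U [v, w]) w (coord 1)"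
  using adm_coord[of "[v, w]" 1] by simp

lemma proj:
  assumes Vs: "set Vs \<subseteq> Obj V" and i: "i < length Vs"
  shows "proj V U Vs i \<in> Hom V (prod_obj V U Vs) (Vs ! i)"
    and "Ar U (prod_obj V U Vs) (Vs ! i) (proj V U Vs i) = (\<lambda>z\<in>Ob U (prod_obj V U Vs). coord i z)"
proof -
  let ?Q = "prod_obj V U Vs"
  have "\<exists>!p. p \<in> Hom V ?Q (Vs ! i) \<and> Ar U ?Q (Vs ! i) p = (\<lambda>z\<in>Ob U ?Q. coord i z)"
    using arrow[OF adm_coord[OF Vs i]] prod_obj_Obj[OF Vs] Vs i
    by (intro ex1I[of _ "arrow ?Q (Vs ! i) (coord i)"] Hom_eqI[of ?Q "Vs ! i"]) auto
  from theI'[OF this]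
  show "proj V U Vs i \<in> Hom V ?Q (Vs ! i)"
    "Ar U ?Q (Vs ! i) (proj V U Vs i) = (\<lambda>z\<in>Ob U ?Q. coord i z)"
    by (auto simp: proj_def)
qed

text \<open>Every morphism that solves the defining equations acts coordinate by coordinate, which
  gives uniqueness by faithfulness and the formula on tuples at once.\<close>

lemma prod_map:
  assumes len: "length Ws = length Vs"
    and Vs: "set Vs \<subseteq> Obj V" and Ws: "set Ws \<subseteq> Obj V"
    and fs: "\<And>i. i < length Vs \<Longrightarrow> fs ! i \<in> Hom V (Vs ! i) (Ws ! i)"
  shows "prod_map V U Vs Ws fs \<in> Hom V (prod_obj V U Vs) (prod_obj V U Ws)"
    and "\<And>xs. list_all2 (\<in>) xs (map (Ob U) Vs) \<Longrightarrow>
      Ar U (prod_obj V U Vs) (prod_obj V U Ws) (prod_map V U Vs Ws fs) (tuple xs)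
        = tuple (map (\<lambda>i. Ar U (Vs ! i) (Ws ! i) (fs ! i) (xs ! i)) [0..<length Vs])"
proof -
  let ?P = "prod_obj V U Vs" and ?Q = "prod_obj V U Ws"
  have P: "?P \<in> Obj V" "Ob U ?P = tuples (map (Ob U) Vs)"
    and Q: "?Q \<in> Obj V" "Ob U ?Q = tuples (map (Ob U) Ws)"
    using Vs Ws prod_obj_Obj Ob_prod_obj by auto
  have VWi: "Vs ! i \<in> Obj V" "Ws ! i \<in> Obj V" if "i < length Vs" for i
    using that Vs Ws len by auto
  define g where "g = (\<lambda>z. tuple (map (\<lambda>i. Ar U (Vs ! i) (Ws ! i) (fs ! i) (coord i z)) [0..<length Vs]))"
  have gi: "adm ?P (Ws ! i) (\<lambda>z. coord i (g z))" if "i < length Vs" for i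
    using adm_comp[OF adm_coord[OF Vs that] adm_Ar[OF VWi[OF that] fs[OF that]]] that
    by (simp add: g_def)
  have g: "adm ?P ?Q g"
    using adm_tuple[of "map (\<lambda>i z. Ar U (Vs ! i) (Ws ! i) (fs ! i) (coord i z)) [0..<length Vs]" Ws ?P]
      gi len P by (simp add: g_def comp_def)
  let ?C = "\<lambda>h. h \<in> Hom V ?P ?Q \<and> (\<forall>i<length Vs. Cmp V ?P ?Q (Ws ! i) (proj V U Ws i) h
        = Cmp V ?P (Vs ! i) (Ws ! i) (fs ! i) (proj V U Vs i))"
  have lhs: "Cmp V ?P ?Q (Ws ! i) (proj V U Ws i) h \<in> Hom V ?P (Ws ! i)"
      "\<And>z. z \<in> Ob U ?P \<Longrightarrow>
        Ar U ?P (Ws ! i) (Cmp V ?P ?Q (Ws ! i) (proj V U Ws i) h) z = coord i (Ar U ?P ?Q h z)"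
    if i: "i < length Vs" and h: "h \<in> Hom V ?P ?Q" for i h
  proof -
    have i': "i < length Ws" using i len by simp
    note pr = proj[OF Ws i']
    show "Cmp V ?P ?Q (Ws ! i) (proj V U Ws i) h \<in> Hom V ?P (Ws ! i)"
      by (rule dom.Cmp_Hom[OF P(1) Q(1) VWi(2)[OF i] h pr(1)])
    fix z
    assume z: "z \<in> Ob U ?P"
    then have "Ar U ?P ?Q h z \<in> Ob U ?Q" using Ar_extensional[OF P(1) Q(1) h] by auto
    then show "Ar U ?P (Ws ! i) (Cmp V ?P ?Q (Ws ! i) (proj V U Ws i) h) z = coord i (Ar U ?P ?Q h z)"
      using Ar_Cmp_apply[OF P(1) Q(1) VWi(2)[OF i] h pr(1) z] pr(2) by simp
  qed
  have rhs: "Cmp V ?P (Vs ! i) (Ws ! i) (fs ! i) (proj V U Vs i) \<in> Hom V ?P (Ws ! i)"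
      "\<And>z. z \<in> Ob U ?P \<Longrightarrow>
        Ar U ?P (Ws ! i) (Cmp V ?P (Vs ! i) (Ws ! i) (fs ! i) (proj V U Vs i)) z = coord i (g z)"
    if i: "i < length Vs" for i
  proof -
    note pr = proj[OF Vs i]
    show "Cmp V ?P (Vs ! i) (Ws ! i) (fs ! i) (proj V U Vs i) \<in> Hom V ?P (Ws ! i)"
      by (rule dom.Cmp_Hom[OF P(1) VWi[OF i] pr(1) fs[OF i]])
    show "Ar U ?P (Ws ! i) (Cmp V ?P (Vs ! i) (Ws ! i) (fs ! i) (proj V U Vs i)) z = coord i (g z)"
      if "z \<in> Ob U ?P" for z
      using Ar_Cmp_apply[OF P(1) VWi[OF i] pr(1) fs[OF i] that] pr(2) that i by (simp add: g_def)
  qed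
  have ar: "Ar U ?P ?Q h z = g z" if h: "?C h" and z: "z \<in> Ob U ?P" for h z
  proof (rule tuples_eqI)
    show "Ar U ?P ?Q h z \<in> tuples (map (Ob U) Ws)"
      using Ar_extensional[OF P(1) Q(1)] h z Q by auto
    show "g z \<in> tuples (map (Ob U) Ws)" using adm_in[OF g z] Q by simp
    show "coord i (Ar U ?P ?Q h z) = coord i (g z)" if "i < length (map (Ob U) Ws)" for i
    proof -
      have i: "i < length Vs" using that len by simp
      show ?thesis
        using lhs(2)[OF i conjunct1[OF h] z] rhs(2)[OF i z] conjunct2[OF h] i by metis
    qed
  qed
  have "?C (arrow ?P ?Q g)"
  proof (intro conjI allI impI)
    show "arrow ?P ?Q g \<in> Hom V ?P ?Q" by (rule arrow[OF g])
    fix i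
    assume i: "i < length Vs"
    show "Cmp V ?P ?Q (Ws ! i) (proj V U Ws i) (arrow ?P ?Q g)
        = Cmp V ?P (Vs ! i) (Ws ! i) (fs ! i) (proj V U Vs i)"
      by (rule Hom_eqI[OF P(1) VWi(2)[OF i] lhs(1)[OF i arrow(1)[OF g]] rhs(1)[OF i]])
        (simp add: lhs(2)[OF i arrow(1)[OF g]] rhs(2)[OF i] arrow(2)[OF g])
  qed
  moreover have "h = k" if h: "?C h" and k: "?C k" for h k
  proof (rule Hom_eqI[OF P(1) Q(1) conjunct1[OF h] conjunct1[OF k]])
    show "Ar U ?P ?Q h x = Ar U ?P ?Q k x" if "x \<in> Ob U ?P" for x
      by (simp only: ar[OF h that] ar[OF k that])
  qed
  ultimately have "\<exists>!h. ?C h" by (intro ex1I[of ?C "arrow ?P ?Q g"])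
  from theI'[OF this] have C: "?C (prod_map V U Vs Ws fs)" unfolding prod_map_def .
  then show "prod_map V U Vs Ws fs \<in> Hom V ?P ?Q" by (rule conjunct1)
  fix xs
  assume "list_all2 (\<in>) xs (map (Ob U) Vs)"
  then show "Ar U ?P ?Q (prod_map V U Vs Ws fs) (tuple xs)
        = tuple (map (\<lambda>i. Ar U (Vs ! i) (Ws ! i) (fs ! i) (xs ! i)) [0..<length Vs])"
    using ar[OF C] P by (simp add: tuple_in_tuples) (simp add: g_def)
qed

text \<open>Since \<open>kpair\<close> prepends an entry to a coded tuple, this is the passage from
  a head and a product over a tail to the product over the longer list.\<close>

lemma adm_tuple_Cons:
  assumes "adm z v f" "adm z (prod_obj V U Vs) g" "set Vs \<subseteq> Obj V"
  shows "adm z (prod_obj V U (v # Vs)) (\<lambda>x. kpair (f x) (g x))"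
proof -
  have sub: "set (v # Vs) \<subseteq> Obj V" and z: "z \<in> Obj V"
    using assms adm_Obj[OF assms(1)] by auto
  have g: "\<exists>xs. g x = tuple xs \<and> list_all2 (\<in>) xs (map (Ob U) Vs)" if "x \<in> Ob U z" for x
    using adm_in[OF assms(2) that] assms(3) by (auto simp: Ob_prod_obj tuples_def)
  have "kpair (f x) (g x) \<in> tuples (map (Ob U) (v # Vs))" if "x \<in> Ob U z" for x
  proof -
    have "f x \<in> Ob U v" using adm_in[OF assms(1) that] .
    then show ?thesis
      using g[OF that] tuple_in_tuples[of "f x # _"] by (auto simp: tuple.simps)
  qed
  moreover have "adm z ((v # Vs) ! i) (\<lambda>x. coord i (kpair (f x) (g x)))" if i: "i < Suc (length Vs)" for i
  proof (cases i)
    case 0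
    have "coord 0 (kpair (f x) (g x)) = f x" if "x \<in> Ob U z" for x
      using g[OF that] coord_tuple[of 0 "f x # _"] by (auto simp: tuple.simps)
    then show ?thesis using adm_eq[OF assms(1)] 0 by simp
  next
    case (Suc j)
    have "coord i (kpair (f x) (g x)) = coord j (g x)" if "x \<in> Ob U z" for x
      using g[OF that] Suc coord_tuple[of i "f x # _"] by (auto simp: tuple.simps)
    moreover have "adm z (Vs ! j) (\<lambda>x. coord j (g x))"
      using assms(2) i Suc unfolding adm_prod_obj_iff[OF assms(3)] by simp
    ultimately show ?thesis using Suc by (auto intro: adm_eq)
  qed
  ultimately show ?thesis
    unfolding adm_prod_obj_iff[OF sub] using z by auto
qed

lemma adm_tuple_tl:
  assumes "v \<in> Obj V" "set Vs \<subseteq> Obj V"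
  shows "adm (prod_obj V U (v # Vs)) (prod_obj V U Vs) tuple_tl"
proof -
  let ?P = "prod_obj V U (v # Vs)"
  have sub: "set (v # Vs) \<subseteq> Obj V" using assms by auto
  have z: "\<exists>x xs. z = tuple (x # xs) \<and> list_all2 (\<in>) xs (map (Ob U) Vs)" if "z \<in> Ob U ?P" for z
    using that by (auto simp: Ob_prod_obj[OF sub] tuples_def list_all2_Cons2)
  have "adm ?P (Vs ! i) (\<lambda>z. coord i (tuple_tl z))" if "i < length Vs" for i
  proof -
    have "coord i (tuple_tl z) = coord (Suc i) z" if "z \<in> Ob U ?P" for z
      using z[OF that] by auto
    then show ?thesis
      using adm_coord[OF sub, of "Suc i"] that by (auto intro: adm_eq)
  qed
  moreover have "tuple_tl \<in> Ob U ?P \<rightarrow> tuples (map (Ob U) Vs)"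
    using z by (fastforce simp: tuple_in_tuples)
  ultimately show ?thesis
    unfolding adm_prod_obj_iff[OF assms(2)] using prod_obj_Obj[OF sub] by blast
qed

text \<open>The coordinates of the identity on tuples are the projections, each followed by the
  comparison of its factor.\<close>

lemma adm_prod_mono:
  assumes "\<And>s. s \<in> set L \<Longrightarrow> adm (f s) (g s) (\<lambda>x. x)"
    and "\<And>s. s \<in> set L \<Longrightarrow> Ob U (f s) = Ob U (g s)"
  shows "adm (prod_obj V U (map f L)) (prod_obj V U (map g L)) (\<lambda>x. x)"
proof -
  have f: "set (map f L) \<subseteq> Obj V" and g: "set (map g L) \<subseteq> Obj V"
    using adm_Obj[OF assms(1)] by auto
  have "Ob U (prod_obj V U (map f L)) = tuples (map (Ob U) (map g L))"
    unfolding Ob_prod_obj[OF f] using assms(2) by (auto intro!: arg_cong[of _ _ tuples])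
  moreover have "adm (prod_obj V U (map f L)) (map g L ! i) (coord i)" if "i < length L" for i
    using adm_comp[OF _ assms(1)[of "L ! i"]] adm_coord[OF f, of i] that by simp
  ultimately show ?thesis
    unfolding adm_prod_obj_iff[OF g] using prod_obj_Obj[OF f] by auto
qed

section \<open>Suprema of chains in a cartesian closed category\<close>

text \<open>Evaluation after \<open>prod_map\<close> can be computed on pairs, so existence and
  uniqueness of transposes become statements about underlying functions. Points of \<open>E\<close>
  need not be functions; they are compared along admissible maps from a common object
  \<open>Z\<close>.\<close>

lemma exponential:
  assumes cc: "cartesian_closed V U" and X: "X \<in> Obj V" and Y: "Y \<in> Obj V"
  shows "\<exists>E e. E \<in> Obj V \<and> adm (prod_obj V U [E, X]) Y e
    \<and> (\<forall>Z f. adm (prod_obj V U [Z, X]) Y f \<longrightarrow> Z \<in> Obj V \<longrightarrow>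
      (\<exists>k. adm Z E k \<and> (\<forall>x\<in>Ob U Z. \<forall>q\<in>Ob U X. e (tuple [k x, q]) = f (tuple [x, q]))))
    \<and> (\<forall>Z k l. adm Z E k \<longrightarrow> adm Z E l \<longrightarrow>
      (\<forall>x\<in>Ob U Z. \<forall>q\<in>Ob U X. e (tuple [k x, q]) = e (tuple [l x, q])) \<longrightarrow>
      (\<forall>x\<in>Ob U Z. k x = l x))"
proof -
  let ?c = "\<lambda>E ev Z g. Cmp V (prod_obj V U [Z, X]) (prod_obj V U [E, X]) Y ev
    (prod_map V U [Z, X] [E, X] [g, Idt V X])"
  obtain E ev where E: "E \<in> Obj V" and ev: "ev \<in> Hom V (prod_obj V U [E, X]) Y"
    and "\<forall>Z\<in>Obj V. \<forall>f\<in>Hom V (prod_obj V U [Z, X]) Y. \<exists>!g. g \<in> Hom V Z E \<and> ?c E ev Z g = f"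
    using cc[unfolded cartesian_closed_def, rule_format, OF X Y] by (elim bexE) (rule that)
  note univ = this(3)[rule_format]
  have P: "prod_obj V U [Z, X] \<in> Obj V" if "Z \<in> Obj V" for Z
    using that X by (intro prod_obj_Obj) auto
  have ObP: "Ob U (prod_obj V U [Z, X]) = tuples [Ob U Z, Ob U X]" if "Z \<in> Obj V" for Z
    using that X by (subst Ob_prod_obj) auto
  define e where "e = Ar U (prod_obj V U [E, X]) Y ev"
  have c: "?c E ev Z g \<in> Hom V (prod_obj V U [Z, X]) Y"
    "\<And>x q. x \<in> Ob U Z \<Longrightarrow> q \<in> Ob U X \<Longrightarrow>
      Ar U (prod_obj V U [Z, X]) Y (?c E ev Z g) (tuple [x, q]) = e (tuple [Ar U Z E g x, q])"
    if Z: "Z \<in> Obj V" and g: "g \<in> Hom V Z E" for Z g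
  proof -
    have "\<And>i. i < 2 \<Longrightarrow> [g, Idt V X] ! i \<in> Hom V ([Z, X] ! i) ([E, X] ! i)"
      using g X dom.Idt_Hom by (auto simp: less_Suc_eq numeral_2_eq_2)
    note pm = prod_map[of "[E, X]" "[Z, X]" "[g, Idt V X]"]
    have pm1: "prod_map V U [Z, X] [E, X] [g, Idt V X] \<in> Hom V (prod_obj V U [Z, X]) (prod_obj V U [E, X])"
      by (rule pm(1)) (use Z E X \<open>\<And>i. i < 2 \<Longrightarrow> _ i\<close> in auto)
    then show "?c E ev Z g \<in> Hom V (prod_obj V U [Z, X]) Y"
      using dom.Cmp_Hom P Z E Y ev by blast
    fix x q
    assume xq: "x \<in> Ob U Z" "q \<in> Ob U X"
    have "Ar U (prod_obj V U [Z, X]) (prod_obj V U [E, X])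
        (prod_map V U [Z, X] [E, X] [g, Idt V X]) (tuple [x, q])
      = tuple (map (\<lambda>i. Ar U ([Z, X] ! i) ([E, X] ! i) ([g, Idt V X] ! i) ([x, q] ! i)) [0..<length [Z, X]])"
      by (rule pm(2)) (use Z E X xq \<open>\<And>i. i < 2 \<Longrightarrow> _ i\<close> in auto)
    also have "\<dots> = tuple [Ar U Z E g x, q]"
      using Ar_Idt[OF X] xq by (simp add: set_cat_def)
    finally show "Ar U (prod_obj V U [Z, X]) Y (?c E ev Z g) (tuple [x, q]) = e (tuple [Ar U Z E g x, q])"
      using Ar_Cmp_apply[OF P[OF Z] P[OF E] Y pm1 ev, of "tuple [x, q]"] xq
      by (simp add: e_def ObP[OF Z] tuples_pair)
  qed
  show ?thesis
  proof (rule exI[of _ E], rule exI[of _ e], intro conjI allI impI ballI)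
    show "E \<in> Obj V" by (rule E)
    show "adm (prod_obj V U [E, X]) Y e"
      unfolding e_def by (rule adm_Ar[OF P[OF E] Y ev])
    fix Z
    show "\<exists>k. adm Z E k \<and> (\<forall>x\<in>Ob U Z. \<forall>q\<in>Ob U X. e (tuple [k x, q]) = f (tuple [x, q]))"
      if Z: "Z \<in> Obj V" and f: "adm (prod_obj V U [Z, X]) Y f" for f
    proof -
      obtain g where g: "g \<in> Hom V Z E" "?c E ev Z g = arrow (prod_obj V U [Z, X]) Y f"
        using univ[OF Z arrow(1)[OF f]] by blast
      have "e (tuple [Ar U Z E g x, q]) = f (tuple [x, q])" if "x \<in> Ob U Z" "q \<in> Ob U X" for x q
        using c(2)[OF Z g(1) that] that arrow(2)[OF f] g(2) by (simp add: ObP[OF Z] tuples_pair)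
      then show ?thesis using adm_Ar[OF Z E g(1)] by blast
    qed
    show "k x = l x"
      if k: "adm Z E k" and l: "adm Z E l" and x: "x \<in> Ob U Z"
        and eq: "\<forall>x\<in>Ob U Z. \<forall>q\<in>Ob U X. e (tuple [k x, q]) = e (tuple [l x, q])" for k l x
    proof -
      have Z: "Z \<in> Obj V" using k by (rule adm_Obj)
      note kh = arrow[OF k] and lh = arrow[OF l]
      \<comment> \<open>Equal evaluations make both lifts transposes of one morphism, to which
        uniqueness is then applied.\<close>
      have "?c E ev Z (arrow Z E k) = ?c E ev Z (arrow Z E l)"
      proof (rule Hom_eqI[OF P[OF Z] Y c(1)[OF Z kh(1)] c(1)[OF Z lh(1)]])
        fix z
        assume "z \<in> Ob U (prod_obj V U [Z, X])"
        then obtain x q where z: "z = tuple [x, q]" and xq: "x \<in> Ob U Z" "q \<in> Ob U X"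
          by (auto simp: ObP[OF Z] tuples_pair)
        show "Ar U (prod_obj V U [Z, X]) Y (?c E ev Z (arrow Z E k)) z
            = Ar U (prod_obj V U [Z, X]) Y (?c E ev Z (arrow Z E l)) z"
          unfolding z c(2)[OF Z kh(1) xq] c(2)[OF Z lh(1) xq] using eq xq kh lh by simp
      qed
      then have "arrow Z E k = arrow Z E l"
        using univ[OF Z c(1)[OF Z lh(1)]] kh(1) lh(1) by blast
      then show ?thesis using kh(2) lh(2) x by (metis restrict_apply')
    qed
  qed
qed

text \<open>Records the half of finality that extends maps from the stages to \<open>w\<close>, for
  all targets \<open>z\<close> and all functions \<open>g\<close> instead of identities in the
  fibre; for the stages of the theorem, the half that puts them below the supremum is
  \<open>omega_le_sup\<close>. The case \<open>m = n\<close> of the first clause makes every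
  \<open>a n\<close> an object.\<close>

definition chain_sup :: "(nat \<Rightarrow> 'v) \<Rightarrow> 'v \<Rightarrow> bool"
  where "chain_sup a w \<longleftrightarrow> (\<forall>m n. m \<le> n \<longrightarrow> adm (a m) (a n) (\<lambda>x. x))
    \<and> w \<in> Obj V \<and> (\<forall>n. Ob U (a n) = Ob U w)
    \<and> (\<forall>z g. (\<forall>n. adm (a n) z g) \<longrightarrow> adm w z g)"

text \<open>The curried maps a n \<rightarrow> Y^Q have the same underlying function for all n: restricted along
  a 0 \<rightarrow> a n, each is a transpose of the same map. So the transpose extends to w.\<close>

lemma adm_prod_chain_sup:
  assumes cc: "cartesian_closed V U" and w: "chain_sup a w" and Q: "Q \<in> Obj V"
    and g: "\<And>n. adm (prod_obj V U [a n, Q]) Y g"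
  shows "adm (prod_obj V U [w, Q]) Y g"
proof -
  have Y: "Y \<in> Obj V" using g adm_Obj by blast
  have le: "adm (a 0) (a n) (\<lambda>x. x)" and ob: "Ob U (a n) = Ob U w" and wO: "w \<in> Obj V"
    and aO: "a n \<in> Obj V" for n
    using w adm_Obj unfolding chain_sup_def by (blast intro: le0)+
  obtain E e where E: "E \<in> Obj V" and e: "adm (prod_obj V U [E, Q]) Y e"
    and "\<forall>Z f. adm (prod_obj V U [Z, Q]) Y f \<longrightarrow> Z \<in> Obj V \<longrightarrow>
      (\<exists>k. adm Z E k \<and> (\<forall>x\<in>Ob U Z. \<forall>q\<in>Ob U Q. e (tuple [k x, q]) = f (tuple [x, q])))"
    and "\<forall>Z k l. adm Z E k \<longrightarrow> adm Z E l \<longrightarrow>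
      (\<forall>x\<in>Ob U Z. \<forall>q\<in>Ob U Q. e (tuple [k x, q]) = e (tuple [l x, q])) \<longrightarrow>
      (\<forall>x\<in>Ob U Z. k x = l x)"
    using exponential[OF cc Q Y] by (elim exE conjE) (rule that)
  note ex = this(3)[rule_format] and uniq = this(4)[rule_format]
  have "\<forall>n. \<exists>k. adm (a n) E k \<and> (\<forall>x\<in>Ob U (a n). \<forall>q\<in>Ob U Q. e (tuple [k x, q]) = g (tuple [x, q]))"
    using ex[OF g aO] by blast
  then obtain k where k: "\<And>n. adm (a n) E (k n)"
    and ke: "\<And>n x q. x \<in> Ob U w \<Longrightarrow> q \<in> Ob U Q \<Longrightarrow> e (tuple [k n x, q]) = g (tuple [x, q])"
    using ob by metis
  have "k n x = k 0 x" if x: "x \<in> Ob U w" for n x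
  proof (rule uniq[where Z = "a 0" and k = "k n" and l = "k 0"])
    show "adm (a 0) E (k n)" using adm_comp[OF le[of n] k[of n]] by simp
    show "adm (a 0) E (k 0)" by (rule k)
  qed (use x in \<open>simp_all add: ob ke\<close>)
  then have "adm (a n) E (k 0)" for n
    by (rule adm_eq[OF k[of n]]) (simp add: ob)
  then have "adm w E (k 0)"
    using w unfolding chain_sup_def by blast
  \<comment> \<open>Uncurrying: on pairs, \<open>g\<close> is the evaluation \<open>e\<close> after
    \<open>k 0\<close> on the first factor.\<close>
  from adm_comp[OF adm_pair[OF adm_comp[OF adm_fst[OF wO Q] this] adm_snd[OF wO Q]] e]
  show ?thesis
    by (rule adm_cong[THEN iffD1, rotated]) (use wO Q ke in \<open>auto simp: Ob_prod_obj tuples_pair\<close>)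
qed

text \<open>One factor at a time; the chain is directed, so the diagonal hypothesis yields all pairs (m, n)
  of indices for the head and the tail of the list.\<close>

lemma adm_prod_list_chain_sup:
  assumes cc: "cartesian_closed V U"
    and "\<And>s. s \<in> set L \<Longrightarrow> chain_sup (\<lambda>n. a n s) (w s)" and "Q \<in> Obj V"
    and "\<And>n. adm (prod_obj V U [Q, prod_obj V U (map (a n) L)]) Y g"
  shows "adm (prod_obj V U [Q, prod_obj V U (map w L)]) Y g"
  using assms(2-)
proof (induction L arbitrary: Q g)
  case Nil
  then show ?case by simp
next
  case (Cons s L)
  note Q = \<open>Q \<in> Obj V\<close>
  have le: "adm (a m t) (a n t) (\<lambda>x. x)" if "t \<in> set (s # L)" "m \<le> n" for t m n
    using Cons.prems(1)[OF that(1)] that(2) unfolding chain_sup_def by blast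
  have ob: "Ob U (a m t) = Ob U (w t)" if "t \<in> set (s # L)" for t m
    using Cons.prems(1)[OF that] unfolding chain_sup_def by blast
  have aO: "a m t \<in> Obj V" if "t \<in> set (s # L)" for t m
    using le[OF that order_refl] by (rule adm_Obj)
  have wO: "w t \<in> Obj V" if "t \<in> set (s # L)" for t
    using Cons.prems(1)[OF that] unfolding chain_sup_def by blast
  have aL: "set (map (a n) L) \<subseteq> Obj V" for n using aO by auto
  have wL: "set (map w L) \<subseteq> Obj V" using wO by auto
  let ?p = "\<lambda>f. prod_obj V U (map f L)"
  have pO: "?p (a n) \<in> Obj V" "?p w \<in> Obj V" for n using prod_obj_Obj aL wL by blast+
  have pairO: "prod_obj V U [u, v] \<in> Obj V" if "u \<in> Obj V" "v \<in> Obj V" for u v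
    using that by (intro prod_obj_Obj) auto
  \<comment> \<open>On coded tuples, \<open>h\<close> regroups ((q, x), xs) as (q, x # xs). The head
    thereby joins the parameter object, which is why the induction is over arbitrary
    \<open>Q\<close> and \<open>g\<close>.\<close>
  define h :: "'u \<Rightarrow> 'u" where "h = (\<lambda>z. tuple [coord 0 (coord 0 z), kpair (coord 1 (coord 0 z)) (coord 1 z)])"
  have "adm (prod_obj V U [prod_obj V U [Q, a m s], ?p (a n)]) Y (\<lambda>z. g (h z))" for m n
  proof -
    let ?N = "max m n" and ?R = "prod_obj V U [prod_obj V U [Q, a m s], ?p (a n)]"
    have QaO: "prod_obj V U [Q, a m s] \<in> Obj V" using pairO Q aO by simp
    note f = adm_fst[OF QaO pO(1)[of n]]
    have "adm ?R Q (\<lambda>z. coord 0 (coord 0 z))"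
      using adm_comp[OF f adm_fst] Q aO by simp
    moreover have "adm ?R (a ?N s) (\<lambda>z. coord 1 (coord 0 z))"
      using adm_comp[OF adm_comp[OF f adm_snd] le[of s m ?N]] Q aO by simp
    moreover have "adm ?R (?p (a ?N)) (coord 1)"
    proof -
      have "adm (?p (a n)) (?p (a ?N)) (\<lambda>x. x)"
        using le ob by (intro adm_prod_mono) auto
      from adm_comp[OF adm_snd[OF QaO pO(1)] this] show ?thesis by simp
    qed
    ultimately have "adm ?R (prod_obj V U [Q, prod_obj V U (map (a ?N) (s # L))]) h"
      unfolding h_def list.map by (intro adm_pair adm_tuple_Cons aL)
    then show ?thesis using adm_comp Cons.prems(3) by blast
  qed
  note split = this
  \<comment> \<open>With the head held at stage \<open>m\<close>, the induction hypothesis moves the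
    whole tail to the supremum.\<close>
  have 1: "adm (prod_obj V U [prod_obj V U [Q, a m s], ?p w]) Y (\<lambda>z. g (h z))" for m
  proof (rule Cons.IH)
    show "chain_sup (\<lambda>n. a n t) (w t)" if "t \<in> set L" for t
      using Cons.prems(1)[of t] that by simp
    show "prod_obj V U [Q, a m s] \<in> Obj V" using pairO Q aO by simp
  qed (rule split)
  let ?R = "prod_obj V U [Q, ?p w]"
  have RO: "?R \<in> Obj V" using pairO Q pO by simp
  \<comment> \<open>Sends (x, (q, xs)) to ((q, x), xs): the head comes first, where
    \<open>adm_prod_chain_sup\<close> expects the factor that varies.\<close>
  define k :: "'u \<Rightarrow> 'u" where "k = (\<lambda>z. tuple [tuple [coord 0 (coord 1 z), coord 0 z], coord 1 (coord 1 z)])"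
  have "adm (prod_obj V U [a m s, ?R]) Y (\<lambda>z. g (h (k z)))" for m
  proof -
    have as: "a m s \<in> Obj V" using aO by simp
    note f = adm_snd[OF as RO]
    have "adm (prod_obj V U [a m s, ?R]) (prod_obj V U [prod_obj V U [Q, a m s], ?p w]) k"
      unfolding k_def
      by (intro adm_pair adm_comp[OF f adm_fst[OF Q pO(2)]] adm_comp[OF f adm_snd[OF Q pO(2)]]
          adm_fst[OF as RO])
    then show ?thesis by (rule adm_comp[OF _ 1])
  qed
  note swap = this
  have 2: "adm (prod_obj V U [w s, ?R]) Y (\<lambda>z. g (h (k z)))"
    using adm_prod_chain_sup[OF cc Cons.prems(1)[of s] RO swap] by simp
  let ?T = "prod_obj V U [Q, prod_obj V U (map w (s # L))]"
  have ws: "w s \<in> Obj V" and wsL: "set (map w (s # L)) \<subseteq> Obj V" using wO by auto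
  \<comment> \<open>Splits (q, x # xs) into (x, (q, xs)), so that \<open>h\<close> after
    \<open>k\<close> after \<open>l\<close> is the identity.\<close>
  define l :: "'u \<Rightarrow> 'u" where "l = (\<lambda>z. tuple [coord 0 (coord 1 z), tuple [coord 0 z, tuple_tl (coord 1 z)]])"
  have l: "adm ?T (prod_obj V U [w s, ?R]) l"
  proof -
    note f = adm_snd[OF Q prod_obj_Obj[OF wsL]]
    have "adm (prod_obj V U (map w (s # L))) (w s) (coord 0)"
      using adm_coord[OF wsL, of 0] by simp
    moreover have "adm (prod_obj V U (map w (s # L))) (?p w) tuple_tl"
      using adm_tuple_tl[OF ws wL] by simp
    ultimately show ?thesis
      unfolding l_def
      by (intro adm_pair adm_comp[OF f] adm_fst[OF Q prod_obj_Obj[OF wsL]])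
  qed
  have "h (k (l z)) = z" if "z \<in> Ob U ?T" for z
  proof -
    have "z \<in> tuples [Ob U Q, tuples (map (Ob U) (map w (s # L)))]"
      using that Q prod_obj_Obj[OF wsL] Ob_prod_obj[OF wsL] by (subst (asm) Ob_prod_obj) auto
    then obtain q x xs where "z = tuple [q, tuple (x # xs)]"
      by (auto simp: tuples_pair tuples_def list_all2_Cons2)
    then show ?thesis by (simp add: h_def k_def l_def flip: tuple.simps(2))
  qed
  then show ?case
    using adm_comp[OF l 2] adm_cong[of ?T "\<lambda>z. g (h (k (l z)))" g Y] by simp
qed

end

section \<open>Structures on the term algebra\<close>

locale term_structures = topological_set_category V U
  for V :: "('v, 'm) cat" and U :: "('v, 'm, 'u::zfc set, 'u \<Rightarrow> 'u) func" +
  fixes S :: "'u set" and \<Sigma> :: "('u, 'v) enriched_signature" and X :: "'u \<Rightarrow> 'v"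
  assumes signature: "is_enriched_signature V S \<Sigma>"
    and X_Obj: "X \<in> Obj (pow_cat V S)"
begin

interpretation pow: topological_category "pow_cat V S" "pow_cat set_cat S" "pow_func U S"
  by (rule topological_category_pow) unfold_locales

abbreviation "T \<equiv> term_carrier U S \<Sigma> X"

abbreviation "Fib \<equiv> fibre (pow_cat V S) (pow_func U S) T"

abbreviation "Fib_le \<equiv> fib_le (pow_cat set_cat S) (pow_cat V S) (pow_func U S) T"

text \<open>This is \<open>sigma_hat\<close> without its restriction, hence independent of the
  structure: one function can be tested against different structures.\<close>

definition hat :: "'u \<Rightarrow> 'u \<Rightarrow> 'u"
  where "hat \<sigma> z = tuple [tuple [\<sigma>, coord 0 z], coord 1 z]"

definition algebraic :: "('u \<Rightarrow> 'v) \<Rightarrow> bool"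
  where "algebraic W \<longleftrightarrow> W \<in> Fib \<and> (\<forall>s\<in>S. adm (X s) (W s) (\<lambda>y. tuple [y]))
    \<and> (\<forall>\<sigma>\<in>Ops \<Sigma>. adm (arity_obj V U \<Sigma> W \<sigma>) (W (out \<Sigma> \<sigma>)) (hat \<sigma>))"

lemma signatureD:
  assumes "\<sigma> \<in> Ops \<Sigma>"
  shows "set (ins \<Sigma> \<sigma>) \<subseteq> S" "out \<Sigma> \<sigma> \<in> S" "par \<Sigma> \<sigma> \<in> Obj V"
  using signature assms by (auto simp: is_enriched_signature_def)

lemma XO: "s \<in> S \<Longrightarrow> X s \<in> Obj V"
  using X_Obj by (auto simp: pow_cat_def)

lemma T_eq: "s \<in> S \<Longrightarrow>
    T s = {t. is_term (underlying_signature U \<Sigma>) S (Ob (pow_func U S) X) s t}"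
  by (simp add: term_carrier_def Term_def)

lemma T_extensional: "T \<in> extensional S"
  by (simp add: term_carrier_def Term_def)

lemma Fib_iff: "W \<in> Fib \<longleftrightarrow> W \<in> extensional S \<and> (\<forall>s\<in>S. W s \<in> Obj V \<and> Ob U (W s) = T s)"
  unfolding fibre_pow_iff[OF T_extensional] by (auto simp: fibre_def)

lemma Fib_le_iff: "Fib_le v w \<longleftrightarrow> v \<in> Fib \<and> w \<in> Fib \<and> (\<forall>s\<in>S. adm (v s) (w s) (\<lambda>x. x))"
  unfolding fib_le_pow_iff[OF T_extensional] fib_le_iff_adm Fib_iff by (auto simp: fibre_def)

text \<open>Smallness of the sets of terms is inherited from the underlying sets of the components
  of \<open>W\<close>.\<close>

lemma T_Obj:
  assumes "W \<in> Fib"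
  shows "T \<in> Obj (pow_cat set_cat S)"
  using assms pow.Ob_Obj[of W] by (simp add: fibre_def)

lemma constant_in_T: "s \<in> S \<Longrightarrow> y \<in> Ob U (X s) \<Longrightarrow> tuple [y] \<in> T s"
  by (simp add: T_eq is_term.const pow_func_def)

lemma hat_in_T:
  assumes \<sigma>: "\<sigma> \<in> Ops \<Sigma>" and z: "z \<in> tuples [Ob U (par \<Sigma> \<sigma>), tuples (map T (ins \<Sigma> \<sigma>))]"
  shows "hat \<sigma> z \<in> T (out \<Sigma> \<sigma>)"
proof -
  let ?\<Sigma> = "underlying_signature U \<Sigma>"
  obtain p ts where p: "p \<in> Ob U (par \<Sigma> \<sigma>)" and ts: "list_all2 (\<in>) ts (map T (ins \<Sigma> \<sigma>))"
    and z: "z = tuple [p, tuple ts]"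
    using z by (auto simp: tuples_pair) (auto simp: tuples_def)
  have "ts ! i \<in> T (ins \<Sigma> \<sigma> ! i)" "ins \<Sigma> \<sigma> ! i \<in> S" if "i < length (ins \<Sigma> \<sigma>)" for i
    using ts that signatureD(1)[OF \<sigma>] by (auto simp: list_all2_conv_all_nth)
  then have "list_all2 (is_term ?\<Sigma> S (Ob (pow_func U S) X)) (ins ?\<Sigma> (tuple [\<sigma>, p])) ts"
    using ts by (simp add: list_all2_conv_all_nth underlying_signature_def T_eq)
  moreover have "tuple [\<sigma>, p] \<in> Ops ?\<Sigma>"
    using \<sigma> p by (auto simp: underlying_signature_def)
  ultimately have "is_term ?\<Sigma> S (Ob (pow_func U S) X) (out ?\<Sigma> (tuple [\<sigma>, p]))
      (tuple [tuple [\<sigma>, p], tuple ts])"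
    by (intro is_term.app)
  then show ?thesis
    using signatureD(2)[OF \<sigma>] by (simp add: T_eq z hat_def underlying_signature_def)
qed

lemma
  assumes W: "W \<in> Fib" and \<sigma>: "\<sigma> \<in> Ops \<Sigma>"
  shows args_Obj: "set (map W (ins \<Sigma> \<sigma>)) \<subseteq> Obj V"
    and Ob_args: "Ob U (prod_obj V U (map W (ins \<Sigma> \<sigma>))) = tuples (map T (ins \<Sigma> \<sigma>))"
    and arity_obj_Obj: "arity_obj V U \<Sigma> W \<sigma> \<in> Obj V"
    and Ob_arity_obj: "Ob U (arity_obj V U \<Sigma> W \<sigma>)
      = tuples [Ob U (par \<Sigma> \<sigma>), tuples (map T (ins \<Sigma> \<sigma>))]"
proof -
  show sub: "set (map W (ins \<Sigma> \<sigma>)) \<subseteq> Obj V"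
    using W signatureD(1)[OF \<sigma>] by (auto simp: Fib_iff)
  have "map (Ob U) (map W (ins \<Sigma> \<sigma>)) = map T (ins \<Sigma> \<sigma>)"
    using W signatureD(1)[OF \<sigma>] by (auto simp: Fib_iff)
  then show args: "Ob U (prod_obj V U (map W (ins \<Sigma> \<sigma>))) = tuples (map T (ins \<Sigma> \<sigma>))"
    unfolding Ob_prod_obj[OF sub] by (rule arg_cong)
  have sub': "set [par \<Sigma> \<sigma>, prod_obj V U (map W (ins \<Sigma> \<sigma>))] \<subseteq> Obj V"
    using signatureD(3)[OF \<sigma>] prod_obj_Obj[OF sub] by simp
  show "arity_obj V U \<Sigma> W \<sigma> \<in> Obj V"
    unfolding arity_obj_def by (rule prod_obj_Obj[OF sub'])
  show "Ob U (arity_obj V U \<Sigma> W \<sigma>) = tuples [Ob U (par \<Sigma> \<sigma>), tuples (map T (ins \<Sigma> \<sigma>))]"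
    unfolding arity_obj_def Ob_prod_obj[OF sub'] by (simp only: list.map args)
qed

text \<open>Two layers of \<open>prod_map\<close>: the outer one is the identity on the parameter,
  the inner one acts on the arguments.\<close>

lemma arity_map:
  assumes A: "A \<in> Fib" and W: "W \<in> Fib" and \<sigma>: "\<sigma> \<in> Ops \<Sigma>"
    and h: "\<And>s. s \<in> S \<Longrightarrow> h s \<in> Hom V (A s) (W s)"
  shows "arity_map V U \<Sigma> A W h \<sigma> \<in> Hom V (arity_obj V U \<Sigma> A \<sigma>) (arity_obj V U \<Sigma> W \<sigma>)"
    and "\<And>p ts. tuple [p, tuple ts] \<in> Ob U (arity_obj V U \<Sigma> A \<sigma>) \<Longrightarrow>
      Ar U (arity_obj V U \<Sigma> A \<sigma>) (arity_obj V U \<Sigma> W \<sigma>) (arity_map V U \<Sigma> A W h \<sigma>) (tuple [p, tuple ts])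
      = tuple [p, tuple (map (\<lambda>i. Ar U (A (ins \<Sigma> \<sigma> ! i)) (W (ins \<Sigma> \<sigma> ! i)) (h (ins \<Sigma> \<sigma> ! i)) (ts ! i))
          [0..<length (ins \<Sigma> \<sigma>)])]"
proof -
  let ?i = "ins \<Sigma> \<sigma>" and ?p = "par \<Sigma> \<sigma>"
  let ?A = "prod_obj V U (map A ?i)" and ?W = "prod_obj V U (map W ?i)"
  let ?m = "prod_map V U (map A ?i) (map W ?i) (map h ?i)"
  note args = args_Obj[OF A \<sigma>] args_Obj[OF W \<sigma>]
  have hi: "map h ?i ! j \<in> Hom V (map A ?i ! j) (map W ?i ! j)" if "j < length (map A ?i)" for j
    using that h signatureD(1)[OF \<sigma>] by (simp add: subset_iff)
  have m: "?m \<in> Hom V ?A ?W"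
    "\<And>xs. list_all2 (\<in>) xs (map (Ob U) (map A ?i)) \<Longrightarrow> Ar U ?A ?W ?m (tuple xs)
      = tuple (map (\<lambda>j. Ar U (map A ?i ! j) (map W ?i ! j) (map h ?i ! j) (xs ! j)) [0..<length (map A ?i)])"
    using prod_map[OF _ args hi] by simp_all
  have O: "set [?p, ?A] \<subseteq> Obj V" "set [?p, ?W] \<subseteq> Obj V"
    using signatureD(3)[OF \<sigma>] prod_obj_Obj[OF args(1)] prod_obj_Obj[OF args(2)] by simp_all
  have "[Idt V ?p, ?m] ! j \<in> Hom V ([?p, ?A] ! j) ([?p, ?W] ! j)" if "j < length [?p, ?A]" for j
    using that m(1) dom.Idt_Hom[OF signatureD(3)[OF \<sigma>]] by (auto simp: less_Suc_eq)
  note M = prod_map[OF _ O this]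
  show "arity_map V U \<Sigma> A W h \<sigma> \<in> Hom V (arity_obj V U \<Sigma> A \<sigma>) (arity_obj V U \<Sigma> W \<sigma>)"
    unfolding arity_map_def arity_obj_def by (rule M) simp_all
  fix p ts
  assume "tuple [p, tuple ts] \<in> Ob U (arity_obj V U \<Sigma> A \<sigma>)"
  then have p: "p \<in> Ob U ?p" and ts: "tuple ts \<in> Ob U ?A"
    using Ob_arity_obj[OF A \<sigma>] Ob_args[OF A \<sigma>] by (simp_all add: tuples_pair)
  then have "list_all2 (\<in>) [p, tuple ts] (map (Ob U) [?p, ?A])" by simp
  note M2 = M(2)[OF _ _ this]
  have ts': "list_all2 (\<in>) ts (map (Ob U) (map A ?i))"
    using ts unfolding Ob_prod_obj[OF args(1)] tuple_in_tuples .
  have "Ar U ?p ?p (Idt V ?p) p = p"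
    using p Ar_Idt[OF signatureD(3)[OF \<sigma>]] by (simp add: set_cat_def)
  moreover have "map (\<lambda>j. Ar U (map A ?i ! j) (map W ?i ! j) (map h ?i ! j) (ts ! j)) [0..<length (map A ?i)]
      = map (\<lambda>i. Ar U (A (ins \<Sigma> \<sigma> ! i)) (W (ins \<Sigma> \<sigma> ! i)) (h (ins \<Sigma> \<sigma> ! i)) (ts ! i)) [0..<length ?i]"
    by simp
  ultimately show "Ar U (arity_obj V U \<Sigma> A \<sigma>) (arity_obj V U \<Sigma> W \<sigma>) (arity_map V U \<Sigma> A W h \<sigma>) (tuple [p, tuple ts])
      = tuple [p, tuple (map (\<lambda>i. Ar U (A (ins \<Sigma> \<sigma> ! i)) (W (ins \<Sigma> \<sigma> ! i)) (h (ins \<Sigma> \<sigma> ! i)) (ts ! i))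
          [0..<length (ins \<Sigma> \<sigma>)])]"
    unfolding arity_map_def arity_obj_def using M2 m(2)[OF ts'] by simp
qed

section \<open>The free carrier as the least algebraic structure\<close>

context
  fixes F :: "('u \<Rightarrow> 'v, 'u \<Rightarrow> 'm, ('u \<Rightarrow> 'v) \<times> ('u \<Rightarrow> 'm), 'u \<Rightarrow> 'm) func"
    and \<eta> :: "('u \<Rightarrow> 'v) \<Rightarrow> 'u \<Rightarrow> 'm"
  assumes adjoint: "left_adjoint (pow_cat V S) (alg_cat V U S \<Sigma>) F alg_forget \<eta>"
    and lifts: "lifts_term_algebra V U S \<Sigma> F \<eta>"
begin

interpretation left_adjoint "pow_cat V S" "alg_cat V U S \<Sigma>" F alg_forget \<eta>
  by (rule adjoint)

abbreviation "free_carrier \<equiv> fst (Ob F X)"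

abbreviation "free_ops \<equiv> snd (Ob F X)"

lemma free_algebra_Obj: "Ob F X \<in> Obj (alg_cat V U S \<Sigma>)"
  by (rule left.Ob_Obj[OF X_Obj])

lemma free_carrier_Fib: "free_carrier \<in> Fib"
proof -
  have "free_carrier \<in> Obj (pow_cat V S)"
    using free_algebra_Obj by (auto simp: alg_cat_def)
  moreover have "Ob (pow_func U S) free_carrier = T"
    using lifts X_Obj
    by (auto simp: lifts_term_algebra_def underlying_algebra_def term_algebra_def
        term_carrier_def split_beta)
  ultimately show ?thesis by (simp add: fibre_def)
qed

lemma free_ops_Hom:
  assumes "\<sigma> \<in> Ops \<Sigma>"
  shows "free_ops \<sigma> \<in> Hom V (arity_obj V U \<Sigma> free_carrier \<sigma>) (free_carrier (out \<Sigma> \<sigma>))"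
  using free_algebra_Obj assms by (auto simp: alg_cat_def)

text \<open>Read off from the equation between the underlying algebra and the term algebra, at the
  symbol that pairs \<sigma> with \<open>p\<close> and at the argument tuple
  \<open>t\<close>.\<close>

lemma free_ops_apply:
  assumes \<sigma>: "\<sigma> \<in> Ops \<Sigma>" and z: "z \<in> Ob U (arity_obj V U \<Sigma> free_carrier \<sigma>)"
  shows "Ar U (arity_obj V U \<Sigma> free_carrier \<sigma>) (free_carrier (out \<Sigma> \<sigma>)) (free_ops \<sigma>) z = hat \<sigma> z"
proof -
  let ?\<Sigma> = "underlying_signature U \<Sigma>"
  obtain p t where p: "p \<in> Ob U (par \<Sigma> \<sigma>)" and t: "t \<in> tuples (map T (ins \<Sigma> \<sigma>))"
    and z: "z = tuple [p, t]"
    using z by (auto simp: Ob_arity_obj[OF free_carrier_Fib \<sigma>] tuples_pair)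
  have eq: "underlying_algebra V U S \<Sigma> (free_carrier, free_ops)
      = term_algebra ?\<Sigma> S (Ob (pow_func U S) X)"
    using lifts X_Obj by (simp add: lifts_term_algebra_def)
  have carrier: "Ob (pow_func U S) free_carrier = T"
    using free_carrier_Fib by (simp add: fibre_def)
  have "tuple [\<sigma>, p] \<in> Ops ?\<Sigma>" and ins: "ins ?\<Sigma> (tuple [\<sigma>, p]) = ins \<Sigma> \<sigma>"
    using \<sigma> p by (auto simp: underlying_signature_def)
  moreover have "snd (underlying_algebra V U S \<Sigma> (free_carrier, free_ops)) (tuple [\<sigma>, p]) t
      = snd (term_algebra ?\<Sigma> S (Ob (pow_func U S) X)) (tuple [\<sigma>, p]) t"
    by (simp only: eq)
  ultimately show ?thesis
    using t unfolding underlying_algebra_def term_algebra_def term_carrier_def[symmetric]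
    by (simp add: carrier z hat_def split_beta)
qed

lemma unit_apply:
  assumes "s \<in> S"
  shows "\<eta> X s \<in> Hom V (X s) (free_carrier s)"
    and "\<And>y. y \<in> Ob U (X s) \<Longrightarrow> Ar U (X s) (free_carrier s) (\<eta> X s) y = tuple [y]"
proof -
  show "\<eta> X s \<in> Hom V (X s) (free_carrier s)"
    using unit_Hom[OF X_Obj] assms by (auto simp: alg_forget_def pow_cat_def)
  have "Ar (pow_func U S) X free_carrier (\<eta> X) = term_incl S (Ob (pow_func U S) X)"
    using lifts X_Obj by (simp add: lifts_term_algebra_def alg_forget_def)
  then have "Ar (pow_func U S) X free_carrier (\<eta> X) s y = term_incl S (Ob (pow_func U S) X) s y" for y
    by simp
  then show "Ar U (X s) (free_carrier s) (\<eta> X s) y = tuple [y]" if "y \<in> Ob U (X s)" for y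
    using that assms by (simp add: pow_func_def term_incl_def)
qed

text \<open>The unit and the operations of the free algebra are morphisms of \<open>V\<close> that
  lie over the inclusion of generators and over term formation.\<close>

lemma free_carrier_algebraic: "algebraic free_carrier"
proof -
  note A = free_carrier_Fib
  have "adm (X s) (free_carrier s) (\<lambda>y. tuple [y])" if s: "s \<in> S" for s
    by (rule adm_eq[OF adm_Ar[OF XO[OF s] _ unit_apply(1)[OF s]] unit_apply(2)[OF s]])
      (use A s in \<open>auto simp: Fib_iff\<close>)
  moreover have "adm (arity_obj V U \<Sigma> free_carrier \<sigma>) (free_carrier (out \<Sigma> \<sigma>)) (hat \<sigma>)"
    if \<sigma>: "\<sigma> \<in> Ops \<Sigma>" for \<sigma>
    by (rule adm_eq[OF adm_Ar[OF arity_obj_Obj[OF A \<sigma>] _ free_ops_Hom[OF \<sigma>]] free_ops_apply[OF \<sigma>]])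
      (use A signatureD(2)[OF \<sigma>] in \<open>auto simp: Fib_iff\<close>)
  ultimately show ?thesis
    using A by (simp add: algebraic_def)
qed

text \<open>By induction on terms, the homomorphism to W given by freeness has the identity as its
  underlying function.\<close>

lemma free_carrier_least:
  assumes "algebraic W"
  shows "Fib_le free_carrier W"
proof -
  note A = free_carrier_Fib
  have W: "W \<in> Fib" and WX: "\<And>s. s \<in> S \<Longrightarrow> adm (X s) (W s) (\<lambda>y. tuple [y])"
    and Wop: "\<And>\<sigma>. \<sigma> \<in> Ops \<Sigma> \<Longrightarrow> adm (arity_obj V U \<Sigma> W \<sigma>) (W (out \<Sigma> \<sigma>)) (hat \<sigma>)"
    using assms by (auto simp: algebraic_def)
  have AO: "free_carrier s \<in> Obj V" "Ob U (free_carrier s) = T s"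
    and WO: "W s \<in> Obj V" "Ob U (W s) = T s" if "s \<in> S" for s
    using A W that by (auto simp: Fib_iff)
  \<comment> \<open>Algebraicity turns \<open>W\<close> into an algebra: its operations
    \<open>w\<close> lift term formation, and \<open>g\<close> lifts the inclusion of
    generators.\<close>
  define w where "w = (\<lambda>\<sigma>\<in>Ops \<Sigma>. arrow (arity_obj V U \<Sigma> W \<sigma>) (W (out \<Sigma> \<sigma>)) (hat \<sigma>))"
  define g where "g = (\<lambda>s\<in>S. arrow (X s) (W s) (\<lambda>y. tuple [y]))"
  have "(W, w) \<in> Obj (alg_cat V U S \<Sigma>)"
    using W arrow(1)[OF Wop] by (auto simp: alg_cat_def fibre_def w_def)
  moreover have "g \<in> Hom (pow_cat V S) X (Ob alg_forget (W, w))"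
    using arrow(1)[OF WX] by (auto simp: pow_cat_def g_def alg_forget_def)
  ultimately obtain h where h: "h \<in> Hom (alg_cat V U S \<Sigma>) (Ob F X) (W, w)"
    and hg: "Cmp (pow_cat V S) X free_carrier W h (\<eta> X) = g"
    using unit_universal[OF X_Obj, of "(W, w)" g] by (auto simp: alg_forget_def)
  have hs: "h s \<in> Hom V (free_carrier s) (W s)" if "s \<in> S" for s
    using h that by (auto simp: alg_cat_def split_beta pow_cat_def)
  have hom: "Cmp V (arity_obj V U \<Sigma> free_carrier \<sigma>) (free_carrier (out \<Sigma> \<sigma>)) (W (out \<Sigma> \<sigma>))
      (h (out \<Sigma> \<sigma>)) (free_ops \<sigma>)
    = Cmp V (arity_obj V U \<Sigma> free_carrier \<sigma>) (arity_obj V U \<Sigma> W \<sigma>) (W (out \<Sigma> \<sigma>)) (w \<sigma>)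
      (arity_map V U \<Sigma> free_carrier W h \<sigma>)" if "\<sigma> \<in> Ops \<Sigma>" for \<sigma>
    using h that by (auto simp: alg_cat_def split_beta)
  define u where "u = (\<lambda>s. Ar U (free_carrier s) (W s) (h s))"
  have u: "u s t = t" if "is_term (underlying_signature U \<Sigma>) S (Ob (pow_func U S) X) s t" for s t
    using that
  proof induction
    case (const s y)
    then have s: "s \<in> S" and y: "y \<in> Ob U (X s)" by (auto simp: pow_func_def)
    have "u s (tuple [y]) = Ar U (X s) (W s) (Cmp V (X s) (free_carrier s) (W s) (h s) (\<eta> X s)) y"
      unfolding Ar_Cmp_apply[OF XO[OF s] AO(1)[OF s] WO(1)[OF s] unit_apply(1)[OF s] hs[OF s] y]
      by (simp add: unit_apply(2)[OF s y] u_def)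
    also have "Cmp V (X s) (free_carrier s) (W s) (h s) (\<eta> X s) = g s"
      using fun_cong[OF hg, of s] s by (simp add: pow_cat_def)
    also have "Ar U (X s) (W s) (g s) y = tuple [y]"
      using arrow(2)[OF WX[OF s]] s y by (simp add: g_def)
    finally show ?case .
  next
    case (app \<tau> ts)
    then obtain \<sigma> p where \<sigma>: "\<sigma> \<in> Ops \<Sigma>" and p: "p \<in> Ob U (par \<Sigma> \<sigma>)" and \<tau>: "\<tau> = tuple [\<sigma>, p]"
      by (auto simp: underlying_signature_def)
    have out: "out (underlying_signature U \<Sigma>) \<tau> = out \<Sigma> \<sigma>"
      and ins: "ins (underlying_signature U \<Sigma>) \<tau> = ins \<Sigma> \<sigma>"
      by (simp_all add: \<tau> underlying_signature_def)
    note len = list_all2_lengthD[OF app(2), unfolded ins]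
    have ts: "ts ! i \<in> T (ins \<Sigma> \<sigma> ! i)" "u (ins \<Sigma> \<sigma> ! i) (ts ! i) = ts ! i"
      if "i < length (ins \<Sigma> \<sigma>)" for i
    proof -
      have "ins \<Sigma> \<sigma> ! i \<in> S" using signatureD(1)[OF \<sigma>] that by auto
      with list_all2_nthD[OF app(2), of i] that
      show "ts ! i \<in> T (ins \<Sigma> \<sigma> ! i)" "u (ins \<Sigma> \<sigma> ! i) (ts ! i) = ts ! i"
        by (auto simp: ins T_eq)
    qed
    let ?A = "arity_obj V U \<Sigma> free_carrier \<sigma>" and ?W = "arity_obj V U \<Sigma> W \<sigma>" and ?o = "out \<Sigma> \<sigma>"
    \<comment> \<open>Both structures lie over the same sets of terms, so \<open>z\<close> is an
      argument for the operations of either algebra.\<close>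
    define z where "z = tuple [p, tuple ts]"
    have z: "z \<in> Ob U ?A" "z \<in> Ob U ?W"
      using p ts(1) len
      by (auto simp: z_def Ob_arity_obj[OF A \<sigma>] Ob_arity_obj[OF W \<sigma>] tuples_pair tuple_in_tuples
          list_all2_conv_all_nth)
    note o = signatureD(2)[OF \<sigma>]
    have "tuple [\<tau>, tuple ts] = Ar U ?A (free_carrier ?o) (free_ops \<sigma>) z"
      using free_ops_apply[OF \<sigma> z(1)] by (simp add: hat_def z_def \<tau>)
    then have "u ?o (tuple [\<tau>, tuple ts])
        = Ar U ?A (W ?o) (Cmp V ?A (free_carrier ?o) (W ?o) (h ?o) (free_ops \<sigma>)) z"
      using Ar_Cmp_apply[OF arity_obj_Obj[OF A \<sigma>] AO(1)[OF o] WO(1)[OF o] free_ops_Hom[OF \<sigma>] hs[OF o] z(1)]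
      by (simp add: u_def)
    \<comment> \<open>As \<open>h\<close> is a homomorphism, it may be applied to the arguments
      first.\<close>
    also have "\<dots> = Ar U ?W (W ?o) (w \<sigma>) (Ar U ?A ?W (arity_map V U \<Sigma> free_carrier W h \<sigma>) z)"
      unfolding hom[OF \<sigma>]
      using \<sigma> by (intro Ar_Cmp_apply arity_obj_Obj A W WO(1)[OF o] arity_map(1) hs z(1))
        (simp_all add: w_def arrow(1)[OF Wop])
    \<comment> \<open>The arguments are fixed by the induction hypothesis, the parameter by
      \<open>arity_map\<close>.\<close>
    also have "Ar U ?A ?W (arity_map V U \<Sigma> free_carrier W h \<sigma>) z = z"
    proof -
      have "map (\<lambda>i. u (ins \<Sigma> \<sigma> ! i) (ts ! i)) [0..<length (ins \<Sigma> \<sigma>)] = ts"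
        using ts(2) len by (auto intro!: nth_equalityI)
      then show ?thesis
        using arity_map(2)[OF A W \<sigma> hs z(1)[unfolded z_def]] by (simp add: z_def u_def)
    qed
    also have "Ar U ?W (W ?o) (w \<sigma>) z = tuple [\<tau>, tuple ts]"
      using arrow(2)[OF Wop[OF \<sigma>]] \<sigma> z(2) by (simp add: w_def hat_def z_def \<tau>)
    finally show ?case by (simp add: out)
  qed
  have "adm (free_carrier s) (W s) (\<lambda>x. x)" if s: "s \<in> S" for s
    using adm_eq[OF adm_Ar[OF AO(1)[OF s] WO(1)[OF s] hs[OF s]], of "\<lambda>x. x"] u AO(2)[OF s] s
    by (simp add: u_def T_eq)
  then show ?thesis
    using A W by (simp add: Fib_le_iff)
qed

end

section \<open>The stages, their bounds and their supremum\<close>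

lemma sigma_hat_eq: "sigma_hat V U \<Sigma> W \<sigma> = restrict (hat \<sigma>) (Ob U (arity_obj V U \<Sigma> W \<sigma>))"
  by (rule ext) (simp add: sigma_hat_def hat_def)

lemma T_small:
  assumes "W \<in> Fib" "s \<in> S"
  shows "T s \<in> Obj set_cat"
  using T_Obj[OF assms(1)] assms(2) by (auto simp: pow_cat_def)

text \<open>The generators form a sink with one member, which every algebraic structure admits, so
  its final lift lies below them all. The structure \<open>W0\<close> makes the sets of terms
  small.\<close>

lemma omega_0:
  assumes "W0 \<in> Fib"
  shows "omega V U S \<Sigma> X 0 \<in> Fib"
    and "s \<in> S \<Longrightarrow> adm (X s) (omega V U S \<Sigma> X 0 s) (\<lambda>y. tuple [y])"
    and "algebraic W \<Longrightarrow> Fib_le (omega V U S \<Sigma> X 0) W"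
proof -
  let ?i = "term_incl S (Ob (pow_func U S) X)"
  have i: "?i \<in> Hom (pow_cat set_cat S) (Ob (pow_func U S) X) T"
    by (auto simp: pow_cat_def set_cat_def term_incl_def pow_func_def constant_in_T)
  have i_adm: "admissible (pow_cat V S) (pow_func U S) X W ?i
      \<longleftrightarrow> (\<forall>s\<in>S. adm (X s) (W s) (\<lambda>y. tuple [y]))" if "W \<in> Fib" for W
    using that X_Obj
    by (subst admissible_pow_iff)
      (auto simp: fibre_def term_incl_def adm_def pow_func_def pow_cat_def)
  have lift: "is_final_lift (pow_cat set_cat S) (pow_cat V S) (pow_func U S) T {(X, ?i)}
      (omega V U S \<Sigma> X 0)"
    unfolding omega.simps
    by (rule pow.final_structure_is_final_lift[OF T_Obj[OF assms]]) (use i X_Obj in auto)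
  then show Fib: "omega V U S \<Sigma> X 0 \<in> Fib"
    by (simp add: is_final_lift_def)
  show "adm (X s) (omega V U S \<Sigma> X 0 s) (\<lambda>y. tuple [y])" if "s \<in> S"
    using lift i_adm[OF Fib] that by (simp add: is_final_lift_def)
  show "Fib_le (omega V U S \<Sigma> X 0) W" if "algebraic W"
    by (rule pow.is_final_lift_fib_le[OF T_Obj[OF assms] lift])
      (use that X_Obj i i_adm in \<open>auto simp: algebraic_def\<close>)
qed

lemma omega_sort_final_lift:
  assumes W: "W \<in> Fib" and s: "s \<in> S"
  shows "is_final_lift set_cat V U (T s)
    {(arity_obj V U \<Sigma> W \<sigma>, sigma_hat V U \<Sigma> W \<sigma>) |\<sigma>. \<sigma> \<in> Ops \<Sigma> \<and> out \<Sigma> \<sigma> = s}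
    (omega_sort V U S \<Sigma> X W s)"
  unfolding omega_sort_def
  by (rule final_structure_is_final_lift[OF T_small[OF W s]])
    (auto simp: arity_obj_Obj[OF W] Ob_arity_obj[OF W] sigma_hat_eq set_cat_def intro: hat_in_T)

lemma omega_sort_Fib:
  assumes "W \<in> Fib"
  shows "(\<lambda>s\<in>S. omega_sort V U S \<Sigma> X W s) \<in> Fib"
  using omega_sort_final_lift[OF assms]
  by (simp add: fibre_pow_iff[OF T_extensional] is_final_lift_def)

lemma omega_sort_adm:
  assumes W: "W \<in> Fib" and \<sigma>: "\<sigma> \<in> Ops \<Sigma>"
  shows "adm (arity_obj V U \<Sigma> W \<sigma>) (omega_sort V U S \<Sigma> X W (out \<Sigma> \<sigma>)) (hat \<sigma>)"
proof -
  note o = signatureD(2)[OF \<sigma>]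
  have "admissible V U (arity_obj V U \<Sigma> W \<sigma>) (omega_sort V U S \<Sigma> X W (out \<Sigma> \<sigma>))
      (sigma_hat V U \<Sigma> W \<sigma>)"
    using omega_sort_final_lift[OF W o] \<sigma> unfolding is_final_lift_def by blast
  then show ?thesis
    using omega_sort_Fib[OF W] arity_obj_Obj[OF W \<sigma>] o by (auto simp: adm_def sigma_hat_eq Fib_iff)
qed

text \<open>The identity on the arity object is the pair of its two coordinates, the second of which
  is compared by \<open>adm_prod_mono\<close>.\<close>

lemma adm_arity_obj_mono:
  assumes le: "Fib_le W W'" and \<sigma>: "\<sigma> \<in> Ops \<Sigma>"
  shows "adm (arity_obj V U \<Sigma> W \<sigma>) (arity_obj V U \<Sigma> W' \<sigma>) (\<lambda>x. x)"
proof -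
  have W: "W \<in> Fib" "W' \<in> Fib" and adm: "\<And>s. s \<in> S \<Longrightarrow> adm (W s) (W' s) (\<lambda>x. x)"
    using le by (auto simp: Fib_le_iff)
  have "adm (prod_obj V U (map W (ins \<Sigma> \<sigma>))) (prod_obj V U (map W' (ins \<Sigma> \<sigma>))) (\<lambda>x. x)"
    by (rule adm_prod_mono) (use W adm signatureD(1)[OF \<sigma>] in \<open>auto simp: Fib_iff\<close>)
  from adm_comp[OF adm_snd this] adm_fst
  have "adm (arity_obj V U \<Sigma> W \<sigma>) (arity_obj V U \<Sigma> W' \<sigma>) (\<lambda>x. tuple [coord 0 x, coord 1 x])"
    unfolding arity_obj_def
    using signatureD(3)[OF \<sigma>] prod_obj_Obj[OF args_Obj[OF W(1) \<sigma>]] by (intro adm_pair) auto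
  then show ?thesis
    by (rule adm_eq) (auto simp: Ob_arity_obj[OF W(1) \<sigma>] tuples_pair)
qed

text \<open>Term formation on \<open>W\<close> factors through the arity object of
  \<open>W'\<close>, from which it is admissible into \<open>W'\<close>; hence \<open>W'\<close>
  admits the sink and lies above its final lift.\<close>

lemma omega_sort_le:
  assumes le: "Fib_le W W'" and W': "algebraic W'"
  shows "Fib_le (\<lambda>s\<in>S. omega_sort V U S \<Sigma> X W s) W'"
proof -
  have W: "W \<in> Fib" using le by (simp add: Fib_le_iff)
  have "fib_le set_cat V U (T s) (omega_sort V U S \<Sigma> X W s) (W' s)" if s: "s \<in> S" for s
  proof (rule is_final_lift_fib_le[OF T_small[OF W s] omega_sort_final_lift[OF W s]])
    show "W' s \<in> fibre V U (T s)"
      using W' s by (simp add: algebraic_def fibre_pow_iff[OF T_extensional])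
    fix u f
    assume "(u, f) \<in> {(arity_obj V U \<Sigma> W \<sigma>, sigma_hat V U \<Sigma> W \<sigma>) |\<sigma>. \<sigma> \<in> Ops \<Sigma> \<and> out \<Sigma> \<sigma> = s}"
    then obtain \<sigma> where u: "u = arity_obj V U \<Sigma> W \<sigma>" and f: "f = sigma_hat V U \<Sigma> W \<sigma>"
      and \<sigma>: "\<sigma> \<in> Ops \<Sigma>" "out \<Sigma> \<sigma> = s" by blast
    have "adm u (W' s) (hat \<sigma>)"
      using adm_comp[OF adm_arity_obj_mono[OF le \<sigma>(1)]] W' \<sigma> by (auto simp: algebraic_def u)
    then show "u \<in> Obj V \<and> f \<in> Hom set_cat (Ob U u) (T s) \<and> admissible V U u (W' s) f"
      using hat_in_T[OF \<sigma>(1)] \<sigma>(2)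
      by (auto simp: adm_def f u sigma_hat_eq set_cat_def Ob_arity_obj[OF W \<sigma>(1)])
  qed
  then show ?thesis
    using W' omega_sort_Fib[OF W]
    by (auto simp: Fib_le_iff fib_le_iff_adm algebraic_def)
qed

lemma omega_Suc:
  assumes "omega V U S \<Sigma> X n \<in> Fib"
  shows "is_fib_sup (pow_cat set_cat S) (pow_cat V S) (pow_func U S) T
    {omega V U S \<Sigma> X n, \<lambda>s\<in>S. omega_sort V U S \<Sigma> X (omega V U S \<Sigma> X n) s}
    (omega V U S \<Sigma> X (Suc n))"
  unfolding omega.simps
  by (rule pow.fib_sup_is_fib_sup[OF T_Obj[OF assms]]) (use assms omega_sort_Fib in simp)

lemma omega_Fib:
  assumes "W0 \<in> Fib"
  shows "omega V U S \<Sigma> X n \<in> Fib"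
proof (induction n)
  case (Suc n)
  from omega_Suc[OF this] show ?case by (simp only: is_fib_sup_def)
qed (rule omega_0(1)[OF assms])

text \<open>In the step, \<open>W\<close> bounds both members of the set whose supremum is the next
  stage: the old stage by induction, the new structure by \<open>omega_sort_le\<close>.\<close>

lemma omega_le_algebraic:
  assumes W: "algebraic W"
  shows "Fib_le (omega V U S \<Sigma> X n) W"
proof (induction n)
  case 0
  have "W \<in> Fib" using W by (simp add: algebraic_def)
  then show ?case using omega_0(3) W by blast
next
  case (Suc n)
  then have "omega V U S \<Sigma> X n \<in> Fib" by (simp add: Fib_le_iff)
  from omega_Suc[OF this] Suc omega_sort_le[OF Suc W] W show ?case
    by (simp add: is_fib_sup_def algebraic_def)
qed

lemma omega_mono:
  assumes W: "W0 \<in> Fib" and s: "s \<in> S" and "m \<le> n"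
  shows "adm (omega V U S \<Sigma> X m s) (omega V U S \<Sigma> X n s) (\<lambda>x. x)"
  using \<open>m \<le> n\<close>
proof (induction n rule: dec_induct)
  case base
  show ?case using omega_Fib[OF W] s by (intro adm_id) (simp add: Fib_iff)
next
  case (step n)
  have "adm (omega V U S \<Sigma> X n s) (omega V U S \<Sigma> X (Suc n) s) (\<lambda>x. x)"
    using omega_Suc[OF omega_Fib[OF W]] s by (simp add: is_fib_sup_def Fib_le_iff del: omega.simps)
  from adm_comp[OF step.IH this] show ?case .
qed

text \<open>Built sort by sort as a final lift rather than through \<open>fib_sup\<close>, so that
  finality against arbitrary maps is available at each sort.\<close>

definition omega_sup :: "'u \<Rightarrow> 'v"
  where "omega_sup = (\<lambda>s\<in>S. final_structure set_cat V U (T s)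
    (range (\<lambda>n. (omega V U S \<Sigma> X n s, Idt set_cat (T s)))))"

lemma omega_sup_final_lift:
  assumes W: "W0 \<in> Fib" and s: "s \<in> S"
  shows "is_final_lift set_cat V U (T s)
    (range (\<lambda>n. (omega V U S \<Sigma> X n s, Idt set_cat (T s)))) (omega_sup s)"
proof -
  have "omega V U S \<Sigma> X n s \<in> Obj V" "Ob U (omega V U S \<Sigma> X n s) = T s" for n
    using omega_Fib[OF W] s by (auto simp: Fib_iff)
  moreover have "Idt set_cat (T s) \<in> Hom set_cat (T s) (T s)"
    by (simp add: set_cat_def)
  ultimately have "is_final_lift set_cat V U (T s)
      (range (\<lambda>n. (omega V U S \<Sigma> X n s, Idt set_cat (T s))))
      (final_structure set_cat V U (T s) (range (\<lambda>n. (omega V U S \<Sigma> X n s, Idt set_cat (T s)))))"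
    by (intro final_structure_is_final_lift[OF T_small[OF W s]]) auto
  then show ?thesis
    using s by (simp add: omega_sup_def)
qed

lemma omega_sup_Fib:
  assumes "W0 \<in> Fib"
  shows "omega_sup \<in> Fib"
  unfolding fibre_pow_iff[OF T_extensional]
  using omega_sup_final_lift[OF assms] by (auto simp: is_final_lift_def omega_sup_def)

text \<open>The sink consists of identities, which drop out under \<open>g\<close>; finality then
  extends a map from all stages to the supremum.\<close>

lemma omega_sup_chain_sup:
  assumes W: "W0 \<in> Fib" and s: "s \<in> S"
  shows "chain_sup (\<lambda>n. omega V U S \<Sigma> X n s) (omega_sup s)"
proof -
  have O: "omega V U S \<Sigma> X n s \<in> Obj V" "Ob U (omega V U S \<Sigma> X n s) = T s" for n
    using omega_Fib[OF W] s by (auto simp: Fib_iff)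
  have sup: "omega_sup s \<in> Obj V" "Ob U (omega_sup s) = T s"
    using omega_sup_Fib[OF W] s by (auto simp: Fib_iff)
  have "adm (omega_sup s) z g" if g: "\<forall>n. adm (omega V U S \<Sigma> X n s) z g" for z g
  proof -
    have "g \<in> T s \<rightarrow> Ob U z" using adm_in[OF g[rule_format, of 0], unfolded O] by blast
    moreover have "adm (omega V U S \<Sigma> X n s) z (\<lambda>x. g (Idt set_cat (T s) x))" for n
      by (rule adm_eq[OF g[rule_format, of n]]) (simp add: O set_cat_def)
    moreover have "z \<in> Obj V" using g adm_Obj by blast
    ultimately show ?thesis
      by (subst final_lift_adm_iff[OF omega_sup_final_lift[OF W s]])
        (auto simp: O set_cat_def)
  qed
  then show ?thesis
    using omega_mono[OF W s] sup O(2) by (simp add: chain_sup_def)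
qed

lemma omega_le_sup:
  assumes W: "W0 \<in> Fib" and s: "s \<in> S"
  shows "adm (omega V U S \<Sigma> X n s) (omega_sup s) (\<lambda>x. x)"
proof -
  have O: "omega V U S \<Sigma> X n s \<in> Obj V" "Ob U (omega V U S \<Sigma> X n s) = T s"
    using omega_Fib[OF W, of n] s by (auto simp: Fib_iff)
  have "admissible V U (omega V U S \<Sigma> X n s) (omega_sup s) (Idt set_cat (T s))"
    using omega_sup_final_lift[OF W s] by (auto simp: is_final_lift_def)
  then show ?thesis
    using O omega_sup_Fib[OF W] s by (simp add: adm_def set_cat_def Fib_iff)
qed

lemma omega_sup_algebraic:
  assumes cc: "cartesian_closed V U" and W: "W0 \<in> Fib"
  shows "algebraic omega_sup"
proof -
  have "adm (X s) (omega_sup s) (\<lambda>y. tuple [y])" if s: "s \<in> S" for s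
    using adm_comp[OF omega_0(2)[OF W s] omega_le_sup[OF W s]] .
  moreover have "adm (arity_obj V U \<Sigma> omega_sup \<sigma>) (omega_sup (out \<Sigma> \<sigma>)) (hat \<sigma>)"
    if \<sigma>: "\<sigma> \<in> Ops \<Sigma>" for \<sigma>
    unfolding arity_obj_def
  proof (rule adm_prod_list_chain_sup[OF cc])
    show "chain_sup (\<lambda>n. omega V U S \<Sigma> X n s) (omega_sup s)" if "s \<in> set (ins \<Sigma> \<sigma>)" for s
      using omega_sup_chain_sup[OF W, of s] signatureD(1)[OF \<sigma>] that by blast
    show "par \<Sigma> \<sigma> \<in> Obj V" by (rule signatureD(3)[OF \<sigma>])
    fix n
    note o = signatureD(2)[OF \<sigma>]
    have "adm (omega_sort V U S \<Sigma> X (omega V U S \<Sigma> X n) (out \<Sigma> \<sigma>))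
        (omega V U S \<Sigma> X (Suc n) (out \<Sigma> \<sigma>)) (\<lambda>x. x)"
      using omega_Suc[OF omega_Fib[OF W]] o
      by (auto simp: is_fib_sup_def Fib_le_iff simp del: omega.simps)
    \<comment> \<open>The route through stage \<open>Suc n\<close> is continued into
      \<open>omega_sup\<close>, so that the target is the same for all \<open>n\<close>, as
      \<open>adm_prod_list_chain_sup\<close> requires.\<close>
    from adm_comp[OF adm_comp[OF omega_sort_adm[OF omega_Fib[OF W] \<sigma>] this] omega_le_sup[OF W o]]
    show "adm (prod_obj V U [par \<Sigma> \<sigma>, prod_obj V U (map (omega V U S \<Sigma> X n) (ins \<Sigma> \<sigma>))])
        (omega_sup (out \<Sigma> \<sigma>)) (hat \<sigma>)"
      by (simp add: arity_obj_def)
  qed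
  ultimately show ?thesis
    using omega_sup_Fib[OF W] by (simp add: algebraic_def)
qed

text \<open>The free carrier lies below \<open>omega_sup\<close> by leastness, and
  \<open>omega_sup\<close> lies below every upper bound \<open>w\<close> of the stages by finality.
  The bound \<open>w\<close> itself witnesses that the fibre is inhabited.\<close>

lemma free_carrier_is_omega_sup:
  assumes cc: "cartesian_closed V U"
    and adjoint: "left_adjoint (pow_cat V S) (alg_cat V U S \<Sigma>) F alg_forget \<eta>"
    and lifts: "lifts_term_algebra V U S \<Sigma> F \<eta>"
  shows "is_fib_sup (pow_cat set_cat S) (pow_cat V S) (pow_func U S) T
    (range (omega V U S \<Sigma> X)) (fst (Ob F X))"
proof -
  let ?A = "fst (Ob F X)"
  note A = free_carrier_algebraic[OF adjoint lifts] and AF = free_carrier_Fib[OF adjoint lifts]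
  have "Fib_le ?A w" if w: "w \<in> Fib" and ub: "\<And>n. Fib_le (omega V U S \<Sigma> X n) w" for w
  proof -
    have "adm (omega_sup s) (w s) (\<lambda>x. x)" if "s \<in> S" for s
      using omega_sup_chain_sup[OF w that] ub that by (auto simp: chain_sup_def Fib_le_iff)
    moreover have "adm (?A s) (omega_sup s) (\<lambda>x. x)" if "s \<in> S" for s
      using free_carrier_least[OF adjoint lifts omega_sup_algebraic[OF cc w]] that
      by (simp add: Fib_le_iff)
    ultimately have "adm (?A s) (w s) (\<lambda>x. x)" if "s \<in> S" for s
      using adm_comp that by blast
    then show ?thesis using AF w by (simp add: Fib_le_iff)
  qed
  then show ?thesis
    using omega_le_algebraic[OF A] omega_Fib[OF AF] AF unfolding is_fib_sup_def by blast
qed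

end

text \<open>Amnesticity makes suprema in a fibre unique, so \<open>is_fib_sup\<close> expresses the
  claimed equation.\<close>

theorem theorem3p3p4:
  fixes V :: "('v, 'm) cat"
    and U :: "('v, 'm, 'u::zfc set, 'u \<Rightarrow> 'u) func"
    and S :: "'u set"
    and \<Sigma> :: "('u, 'v) enriched_signature"
    and F :: "('u \<Rightarrow> 'v, 'u \<Rightarrow> 'm, ('u \<Rightarrow> 'v) \<times> ('u \<Rightarrow> 'm), 'u \<Rightarrow> 'm) func"
    and \<eta> :: "('u \<Rightarrow> 'v) \<Rightarrow> 'u \<Rightarrow> 'm"
    and X :: "'u \<Rightarrow> 'v"
  assumes "topological_category V set_cat U"
    and "cartesian_closed V U"
    and "small S"
    and "is_enriched_signature V S \<Sigma>"
    and "left_adjoint (pow_cat V S) (alg_cat V U S \<Sigma>) F alg_forget \<eta>"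
    and "lifts_term_algebra V U S \<Sigma> F \<eta>"
    and "X \<in> Obj (pow_cat V S)"
  shows "is_fib_sup (pow_cat set_cat S) (pow_cat V S) (pow_func U S) (term_carrier U S \<Sigma> X)
    (range (omega V U S \<Sigma> X)) (Ob alg_forget (Ob F X))"
proof -
  interpret topological_category V set_cat U by fact
  interpret term_structures V U S \<Sigma> X
    by unfold_locales fact+
  show ?thesis
    using free_carrier_is_omega_sup[OF assms(2,5,6)] by (simp add: alg_forget_def)
qed

end
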